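(* Let $B$ be a finite group of nilpotency class 2 of odd order. Then the elements $$X_\chi=\sum_{l\in L(B)}\chi(l)\,l,\qquad \chi\in L(B)^*,$$ form an orthonormal basis of $\mathbb C[B]$ (with respect to the normalized inner product given in the context). For every orbit $\Omega$ of the coadjoint representation of $B$ in $L(B)^*$, the subspace $V_\Omega=\operatorname{span}(X_\chi)_{\chi\in\Omega}$ is a two-sided ideal of the group algebra $\mathbb C[B]$; the restriction to $V_\Omega$ of the regular representation of $B$ in $\mathbb C[B]$ (either the left one, $g\cdot x=gx$, or the right one, $g\cdot x=xg^{-1}$) is isotypic; and $$\mathbb C[B]=\bigoplus_{\Omega\in\mathcal O(B)}V_\Omega$$ is the decomposition of the regular representation of $B$ in $\mathbb C[B]$ into the direct sum of its isotypic components, where $\mathcal O(B)$ is the set of orbits of the coadjoint representation of $B$.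
   Context: A group $B$ is said to be of nilpotency class 2 if $B/A$ is abelian, where $A$ is the center of $B$ (abelian groups are included). An abelian group $A$ (written additively) is 2-divisible if $a\mapsto a+a$ is an automorphism of $A$; then $a/2$ denotes the image of $a$ under the inverse. A finite group of odd order has 2-divisible center. The Lie ring $L(B)$: let $B$ be a group of nilpotency class 2 with 2-divisible center $A$, and $C=B/A$ (both written additively). Choose a set-theoretic section $s:C\to B$; every $b\in B$ is uniquely $b=a\cdot s(c)$ with $a\in A$, $c\in C$, written $b=(a,c)$. Put $\psi(c_1,c_2)=s(c_1)s(c_2)s(c_1+c_2)^{-1}\in A$, $\phi(c_1,c_2)=\frac{\psi(c_1,c_2)+\psi(c_2,c_1)}{2}$, $\eta(c_1,c_2)=\psi(c_1,c_2)-\psi(c_2,c_1)$. $L(B)$ is the Lie ring with the same underlying set as $B$, addition $(a_1,c_1)+(a_2,c_2)=(a_1+a_2+\phi(c_1,c_2),\,c_1+c_2)$ and bracket $[(a_1,c_1),(a_2,c_2)]=\eta(c_1,c_2)\in A\subset B$. This does not depend on the choice of $s$. Elements of $L(B)$ are elements of $B$, so $\mathbb C[L(B)]$ and $\mathbb C[B]$ are the same vector space. $L(B)^*$ is the group of unitary characters of the additive group of $L(B)$. The adjoint representation is $\operatorname{Ad}(b)(l)=b\cdot l\cdot b^{-1}$ (an element of $B$ regarded as an element of $L(B)$), and the coadjoint representation is the left action of $B$ on $L(B)^*$ given by $\operatorname{Ad}^*(b)(\chi)(l)=\chi(\operatorname{Ad}(b^{-1})(l))$. Inner product on $\mathbb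 C[B]$: $\left\langle\sum_{g}x_g g,\sum_g y_g g\right\rangle=\frac1{|B|}\sum_{g\in B}x_g\overline{y_g}$. *)

theory Defs
  imports Complex_Main "HOL-Library.Function_Algebras" "HOL-Algebra.Group_Action"
    "HOL-Algebra.Coset" "HOL-Algebra.Ideal"
begin

section \<open>Groups of nilpotency class 2\<close>

definition group_center :: "('a, 'm) monoid_scheme \<Rightarrow> 'a set" where
  "group_center G = {z \<in> carrier G. \<forall>g \<in> carrier G. z \<otimes>\<^bsub>G\<^esub> g = g \<otimes>\<^bsub>G\<^esub> z}"

definition nilpotent_class_2 :: "('a, 'm) monoid_scheme \<Rightarrow> bool" where
  "nilpotent_class_2 G \<longleftrightarrow> group G \<and> comm_group (G Mod group_center G)"


section \<open>The Lie ring of a group of nilpotency class 2\<close>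

text \<open>
  The group \<open>B\<close> and its center \<open>A\<close> are written multiplicatively here, as is \<open>C = B/A\<close>, whose
  elements are cosets. So \<open>a/2\<close> is the preimage of \<open>a\<close> under squaring in \<open>A\<close>, and the element
  \<open>(a, c)\<close> is \<open>a \<otimes> s c\<close>.
\<close>

definition central_section :: "('a, 'm) monoid_scheme \<Rightarrow> ('a set \<Rightarrow> 'a) \<Rightarrow> bool" where
  "central_section G s \<longleftrightarrow> (\<forall>c \<in> carrier (G Mod group_center G). s c \<in> c)"

definition half :: "('a, 'm) monoid_scheme \<Rightarrow> 'a \<Rightarrow> 'a" where
  "half G a = the_inv_into (group_center G) (\<lambda>z. z \<otimes>\<^bsub>G\<^esub> z) a"

definition psi :: "('a, 'm) monoid_scheme \<Rightarrow> ('a set \<Rightarrow> 'a) \<Rightarrow> 'a set \<Rightarrow> 'a set \<Rightarrow> 'a" where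
  "psi G s c1 c2 = s c1 \<otimes>\<^bsub>G\<^esub> s c2 \<otimes>\<^bsub>G\<^esub> inv\<^bsub>G\<^esub> (s (c1 \<otimes>\<^bsub>G Mod group_center G\<^esub> c2))"

definition phi :: "('a, 'm) monoid_scheme \<Rightarrow> ('a set \<Rightarrow> 'a) \<Rightarrow> 'a set \<Rightarrow> 'a set \<Rightarrow> 'a" where
  "phi G s c1 c2 = half G (psi G s c1 c2 \<otimes>\<^bsub>G\<^esub> psi G s c2 c1)"

definition eta :: "('a, 'm) monoid_scheme \<Rightarrow> ('a set \<Rightarrow> 'a) \<Rightarrow> 'a set \<Rightarrow> 'a set \<Rightarrow> 'a" where
  "eta G s c1 c2 = psi G s c1 c2 \<otimes>\<^bsub>G\<^esub> inv\<^bsub>G\<^esub> (psi G s c2 c1)"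

definition C_part :: "('a, 'm) monoid_scheme \<Rightarrow> 'a \<Rightarrow> 'a set" where
  "C_part G b = group_center G #>\<^bsub>G\<^esub> b"

definition A_part :: "('a, 'm) monoid_scheme \<Rightarrow> ('a set \<Rightarrow> 'a) \<Rightarrow> 'a \<Rightarrow> 'a" where
  "A_part G s b = b \<otimes>\<^bsub>G\<^esub> inv\<^bsub>G\<^esub> (s (C_part G b))"

record 'a lie_ring = "'a partial_object" +
  lie_add :: "'a \<Rightarrow> 'a \<Rightarrow> 'a"
  lie_zero :: 'a
  lie_bracket :: "'a \<Rightarrow> 'a \<Rightarrow> 'a"

text \<open>
  The zero of \<open>L(B)\<close> is the unit of \<open>B\<close> even if \<open>s\<close> is not normalized: \<open>\<phi>(0,0) = s(0)\<close>, so the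
  neutral element for the addition is \<open>(-s(0), 0)\<close>. The bracket \<open>\<eta>(c\<^sub>1, c\<^sub>2)\<close> is
  taken in \<open>A\<close> as a subset of \<open>B\<close>, not as a second coordinate relative to \<open>s\<close>.
\<close>

definition lie_ring_of :: "('a, 'm) monoid_scheme \<Rightarrow> ('a set \<Rightarrow> 'a) \<Rightarrow> 'a lie_ring" where
  "lie_ring_of G s = \<lparr>
     carrier = carrier G,
     lie_add = (\<lambda>b1 b2.
       A_part G s b1 \<otimes>\<^bsub>G\<^esub> A_part G s b2 \<otimes>\<^bsub>G\<^esub> phi G s (C_part G b1) (C_part G b2)
         \<otimes>\<^bsub>G\<^esub> s (C_part G b1 \<otimes>\<^bsub>G Mod group_center G\<^esub> C_part G b2)),
     lie_zero = \<one>\<^bsub>G\<^esub>,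
     lie_bracket = (\<lambda>b1 b2. eta G s (C_part G b1) (C_part G b2)) \<rparr>"

definition additive_group :: "('a, 'm) lie_ring_scheme \<Rightarrow> 'a monoid" where
  "additive_group L = \<lparr> carrier = carrier L, mult = lie_add L, one = lie_zero L \<rparr>"


section \<open>Unitary characters and the coadjoint action\<close>

definition circle_group :: "complex monoid" where
  "circle_group = \<lparr> carrier = {z. cmod z = 1}, mult = (*), one = 1 \<rparr>"

text \<open>Characters are made extensional so that each one is represented by exactly one function.\<close>

definition unitary_characters :: "('a, 'm) monoid_scheme \<Rightarrow> ('a \<Rightarrow> complex) set" where
  "unitary_characters H = hom H circle_group \<inter> extensional (carrier H)"

definition Ad :: "('a, 'm) monoid_scheme \<Rightarrow> 'a \<Rightarrow> 'a \<Rightarrow> 'a" where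
  "Ad G b l = b \<otimes>\<^bsub>G\<^esub> l \<otimes>\<^bsub>G\<^esub> inv\<^bsub>G\<^esub> b"

definition coAd :: "('a, 'm) monoid_scheme \<Rightarrow> 'a \<Rightarrow> ('a \<Rightarrow> complex) \<Rightarrow> ('a \<Rightarrow> complex)" where
  "coAd G b \<chi> = (\<lambda>l \<in> carrier G. \<chi> (Ad G (inv\<^bsub>G\<^esub> b) l))"


section \<open>Complex vector spaces of functions\<close>

definition cscale :: "complex \<Rightarrow> ('b \<Rightarrow> complex) \<Rightarrow> ('b \<Rightarrow> complex)" where
  "cscale c f = (\<lambda>x. c * f x)"

global_interpretation cfun: vector_space "cscale :: complex \<Rightarrow> ('b \<Rightarrow> complex) \<Rightarrow> ('b \<Rightarrow> complex)"
  by unfold_locales (auto simp: cscale_def fun_eq_iff algebra_simps)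

text \<open>Internal direct sum of a finite family of subspaces.\<close>

definition direct_sum :: "('b \<Rightarrow> complex) set \<Rightarrow> 'i set \<Rightarrow> ('i \<Rightarrow> ('b \<Rightarrow> complex) set) \<Rightarrow> bool" where
  "direct_sum W I V \<longleftrightarrow>
     finite I \<and> cfun.subspace W \<and> (\<forall>i \<in> I. cfun.subspace (V i) \<and> V i \<subseteq> W) \<and>
     (\<forall>w \<in> W. \<exists>!v. v \<in> (\<Pi>\<^sub>E i \<in> I. V i) \<and> w = (\<Sum>i \<in> I. v i))"

definition orthonormal_basis ::
  "(('b \<Rightarrow> complex) \<Rightarrow> ('b \<Rightarrow> complex) \<Rightarrow> complex) \<Rightarrow> ('b \<Rightarrow> complex) set \<Rightarrow> 'i set
     \<Rightarrow> ('i \<Rightarrow> ('b \<Rightarrow> complex)) \<Rightarrow> bool" where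
  "orthonormal_basis ip W I e \<longleftrightarrow>
     inj_on e I \<and> cfun.independent (e ` I) \<and> cfun.span (e ` I) = W \<and>
     (\<forall>i \<in> I. \<forall>j \<in> I. ip (e i) (e j) = (if i = j then 1 else 0))"


section \<open>Complex linear representations\<close>

definition is_rep ::
  "('g, 'm) monoid_scheme \<Rightarrow> ('g \<Rightarrow> ('b \<Rightarrow> complex) \<Rightarrow> ('b \<Rightarrow> complex))
     \<Rightarrow> ('b \<Rightarrow> complex) set \<Rightarrow> bool" where
  "is_rep G \<rho> W \<longleftrightarrow>
     cfun.subspace W \<and>
     (\<forall>g \<in> carrier G. \<forall>w \<in> W. \<rho> g w \<in> W) \<and>
     (\<forall>g \<in> carrier G. \<forall>v \<in> W. \<forall>w \<in> W. \<rho> g (v + w) = \<rho> g v + \<rho> g w) \<and>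
     (\<forall>g \<in> carrier G. \<forall>c. \<forall>w \<in> W. \<rho> g (cscale c w) = cscale c (\<rho> g w)) \<and>
     (\<forall>w \<in> W. \<rho> \<one>\<^bsub>G\<^esub> w = w) \<and>
     (\<forall>g \<in> carrier G. \<forall>h \<in> carrier G. \<forall>w \<in> W. \<rho> (g \<otimes>\<^bsub>G\<^esub> h) w = \<rho> g (\<rho> h w))"

text \<open>
  A subrepresentation of \<open>(\<rho>, W)\<close> is a subset \<open>U \<subseteq> W\<close> with \<open>is_rep G \<rho> U\<close>; the restriction of
  \<open>\<rho>\<close> to \<open>U\<close> is not a separate function.
\<close>

definition irreducible_rep ::
  "('g, 'm) monoid_scheme \<Rightarrow> ('g \<Rightarrow> ('b \<Rightarrow> complex) \<Rightarrow> ('b \<Rightarrow> complex))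
     \<Rightarrow> ('b \<Rightarrow> complex) set \<Rightarrow> bool" where
  "irreducible_rep G \<rho> W \<longleftrightarrow>
     is_rep G \<rho> W \<and> W \<noteq> {0} \<and> (\<forall>U. U \<subseteq> W \<and> is_rep G \<rho> U \<longrightarrow> U = {0} \<or> U = W)"

definition rep_iso ::
  "('g, 'm) monoid_scheme
     \<Rightarrow> ('g \<Rightarrow> ('b \<Rightarrow> complex) \<Rightarrow> ('b \<Rightarrow> complex)) \<Rightarrow> ('b \<Rightarrow> complex) set
     \<Rightarrow> ('g \<Rightarrow> ('d \<Rightarrow> complex) \<Rightarrow> ('d \<Rightarrow> complex)) \<Rightarrow> ('d \<Rightarrow> complex) set \<Rightarrow> bool" where
  "rep_iso G \<rho> U \<sigma> W \<longleftrightarrow> (\<exists>T.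
     bij_betw T U W \<and>
     (\<forall>u \<in> U. \<forall>v \<in> U. T (u + v) = T u + T v) \<and>
     (\<forall>c. \<forall>u \<in> U. T (cscale c u) = cscale c (T u)) \<and>
     (\<forall>g \<in> carrier G. \<forall>u \<in> U. T (\<rho> g u) = \<sigma> g (T u)))"

text \<open>
  Isotypic: a direct sum of finitely many, and at least one, pairwise isomorphic irreducible
  subrepresentations. In particular the zero representation is not isotypic.
\<close>

definition isotypic ::
  "('g, 'm) monoid_scheme \<Rightarrow> ('g \<Rightarrow> ('b \<Rightarrow> complex) \<Rightarrow> ('b \<Rightarrow> complex))
     \<Rightarrow> ('b \<Rightarrow> complex) set \<Rightarrow> bool" where
  "isotypic G \<rho> W \<longleftrightarrow> is_rep G \<rho> W \<and> (\<exists>n > 0. \<exists>U :: nat \<Rightarrow> ('b \<Rightarrow> complex) set.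
     direct_sum W {..<n} U \<and> (\<forall>i < n. irreducible_rep G \<rho> (U i)) \<and>
     (\<forall>i < n. \<forall>j < n. rep_iso G \<rho> (U i) \<rho> (U j)))"

definition isotypic_component ::
  "('g, 'm) monoid_scheme \<Rightarrow> ('g \<Rightarrow> ('b \<Rightarrow> complex) \<Rightarrow> ('b \<Rightarrow> complex))
     \<Rightarrow> ('b \<Rightarrow> complex) set \<Rightarrow> ('b \<Rightarrow> complex) set \<Rightarrow> ('b \<Rightarrow> complex) set" where
  "isotypic_component G \<rho> W U =
     cfun.span (\<Union>{U'. U' \<subseteq> W \<and> irreducible_rep G \<rho> U' \<and> rep_iso G \<rho> U \<rho> U'})"

definition isotypic_components ::
  "('g, 'm) monoid_scheme \<Rightarrow> ('g \<Rightarrow> ('b \<Rightarrow> complex) \<Rightarrow> ('b \<Rightarrow> complex))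
     \<Rightarrow> ('b \<Rightarrow> complex) set \<Rightarrow> ('b \<Rightarrow> complex) set set" where
  "isotypic_components G \<rho> W =
     {isotypic_component G \<rho> W U | U. U \<subseteq> W \<and> irreducible_rep G \<rho> U}"

definition isotypic_decomposition ::
  "('g, 'm) monoid_scheme \<Rightarrow> ('g \<Rightarrow> ('b \<Rightarrow> complex) \<Rightarrow> ('b \<Rightarrow> complex))
     \<Rightarrow> ('b \<Rightarrow> complex) set \<Rightarrow> 'i set \<Rightarrow> ('i \<Rightarrow> ('b \<Rightarrow> complex) set) \<Rightarrow> bool" where
  "isotypic_decomposition G \<rho> W I V \<longleftrightarrow>
     is_rep G \<rho> W \<and> direct_sum W I V \<and> bij_betw V I (isotypic_components G \<rho> W)"


section \<open>The group algebra\<close>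

text \<open>
  An element \<open>\<Sum>\<^sub>g x\<^sub>g g\<close> of the group algebra of a finite group is the function \<open>g \<mapsto> x\<^sub>g\<close>, equal to
  0 outside the carrier. The product is the bilinear extension of the group law; it is not the
  pointwise product of functions.
\<close>

definition galg_basis :: "'a \<Rightarrow> ('a \<Rightarrow> complex)" where
  "galg_basis g = (\<lambda>x. if x = g then 1 else 0)"

definition galg_mult ::
  "('a, 'm) monoid_scheme \<Rightarrow> ('a \<Rightarrow> complex) \<Rightarrow> ('a \<Rightarrow> complex) \<Rightarrow> ('a \<Rightarrow> complex)" where
  "galg_mult G x y =
     (\<Sum>g \<in> carrier G. \<Sum>h \<in> carrier G. cscale (x g * y h) (galg_basis (g \<otimes>\<^bsub>G\<^esub> h)))"

definition group_algebra :: "('a, 'm) monoid_scheme \<Rightarrow> ('a \<Rightarrow> complex) ring" where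
  "group_algebra G = \<lparr>
     carrier = {x. \<forall>g. g \<notin> carrier G \<longrightarrow> x g = 0},
     mult = galg_mult G,
     one = galg_basis \<one>\<^bsub>G\<^esub>,
     zero = 0,
     add = (+) \<rparr>"

definition galg_inner ::
  "('a, 'm) monoid_scheme \<Rightarrow> ('a \<Rightarrow> complex) \<Rightarrow> ('a \<Rightarrow> complex) \<Rightarrow> complex" where
  "galg_inner G x y = 1 / of_nat (order G) * (\<Sum>g \<in> carrier G. x g * cnj (y g))"

definition left_regular :: "('a, 'm) monoid_scheme \<Rightarrow> 'a \<Rightarrow> ('a \<Rightarrow> complex) \<Rightarrow> ('a \<Rightarrow> complex)" where
  "left_regular G g x = galg_basis g \<otimes>\<^bsub>group_algebra G\<^esub> x"

definition right_regular :: "('a, 'm) monoid_scheme \<Rightarrow> 'a \<Rightarrow> ('a \<Rightarrow> complex) \<Rightarrow> ('a \<Rightarrow> complex)" where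
  "right_regular G g x = x \<otimes>\<^bsub>group_algebra G\<^esub> galg_basis (inv\<^bsub>G\<^esub> g)"


section \<open>The elements \<open>X\<^sub>\<chi>\<close> and the subspaces \<open>V\<^sub>\<Omega>\<close>\<close>

definition X_char :: "('a, 'm) lie_ring_scheme \<Rightarrow> ('a \<Rightarrow> complex) \<Rightarrow> ('a \<Rightarrow> complex)" where
  "X_char L \<chi> = (\<Sum>l \<in> carrier L. cscale (\<chi> l) (galg_basis l))"

definition V_orbit ::
  "('a, 'm) lie_ring_scheme \<Rightarrow> ('a \<Rightarrow> complex) set \<Rightarrow> ('a \<Rightarrow> complex) set" where
  "V_orbit L \<Omega> = cfun.span (X_char L ` \<Omega>)"

abbreviation lie_characters :: "('a, 'm) lie_ring_scheme \<Rightarrow> ('a \<Rightarrow> complex) set" where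
  "lie_characters L \<equiv> unitary_characters (additive_group L)"

definition coadjoint_orbits ::
  "('a, 'm) monoid_scheme \<Rightarrow> 'a lie_ring \<Rightarrow> ('a \<Rightarrow> complex) set set" where
  "coadjoint_orbits G L = orbits G (lie_characters L) (coAd G)"

end

theory Submission
  imports Defs "HOL-Algebra.Multiplicative_Group"
begin

text \<open>
  Write \<open>\<surd>g\<close> for the unique square root of \<open>g\<close> in \<open>B\<close>. The addition of \<open>L(B)\<close> is
  \<open>x + y = \<surd>x y \<surd>x\<close>, so \<open>g\<inverse>x = g\<inverse> + k\<inverse>xk\<close> with \<open>k = \<surd>g\<close>: multiplication by \<open>g\<close>, on either side,
  sends \<open>X\<^sub>\<chi>\<close> to a multiple of \<open>X\<close> at \<open>Ad\<^sup>*(k)(\<chi>)\<close>. Hence each \<open>V\<^sub>\<Omega>\<close> is a two-sided ideal.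
  It is minimal: the operators \<open>u \<mapsto> gug\<close> act on \<open>X\<^sub>\<chi>\<close> by the scalars \<open>\<chi>(-2g)\<close>, which separate the
  characters, so a nonzero two-sided ideal inside \<open>V\<^sub>\<Omega>\<close> contains some \<open>X\<^sub>\<chi>\<close>, and then, by
  conjugation, all of them.

  If the group algebra is a direct sum of minimal two-sided ideals \<open>V\<^sub>i\<close>, these are the isotypic
  components: for an irreducible left ideal \<open>U \<subseteq> V\<^sub>i\<close> the right translates \<open>Ug\<close> are isomorphic to \<open>U\<close>
  and span \<open>V\<^sub>i\<close>, while the \<open>V\<^sub>i\<close>-component of \<open>1\<close> acts as the identity on \<open>V\<^sub>i\<close> and as zero on the
  other summands, and therefore no \<open>V\<^sub>i\<close> and \<open>V\<^sub>j\<close> share an isomorphism type.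
\<close>

section \<open>Subspaces and direct sums\<close>

lemma sum_fun_apply:
  fixes f :: "'i \<Rightarrow> 'b \<Rightarrow> 'c::comm_monoid_add"
  shows "(\<Sum>i\<in>I. f i) x = (\<Sum>i\<in>I. f i x)"
  by (induction I rule: infinite_finite_induct) auto

lemma cscale_apply: "cscale c f x = c * f x"
  by (simp add: cscale_def)

text \<open>The difference of two decompositions of the same vector is a decomposition of zero, so
  uniqueness only has to be checked at zero. Families are cut down with \<open>restrict\<close>
  because \<open>direct_sum\<close> asks for extensional ones.\<close>

lemma direct_sumI:
  assumes "finite I" and W: "cfun.subspace W"
    and V: "\<And>i. i \<in> I \<Longrightarrow> cfun.subspace (V i)" "\<And>i. i \<in> I \<Longrightarrow> V i \<subseteq> W"
    and ex: "\<And>w. w \<in> W \<Longrightarrow> \<exists>v. (\<forall>i\<in>I. v i \<in> V i) \<and> w = (\<Sum>i\<in>I. v i)"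
    and indep: "\<And>v i. (\<And>i. i \<in> I \<Longrightarrow> v i \<in> V i) \<Longrightarrow> (\<Sum>i\<in>I. v i) = 0 \<Longrightarrow> i \<in> I \<Longrightarrow> v i = 0"
  shows "direct_sum W I V"
proof -
  have "\<exists>!v. v \<in> (\<Pi>\<^sub>E i \<in> I. V i) \<and> w = (\<Sum>i \<in> I. v i)" if w: "w \<in> W" for w
  proof (rule ex_ex1I)
    obtain v where v: "\<forall>i\<in>I. v i \<in> V i" "w = (\<Sum>i\<in>I. v i)" using ex[OF w] by blast
    then have "restrict v I \<in> (\<Pi>\<^sub>E i \<in> I. V i) \<and> w = (\<Sum>i \<in> I. restrict v I i)" by auto
    then show "\<exists>v. v \<in> (\<Pi>\<^sub>E i \<in> I. V i) \<and> w = (\<Sum>i \<in> I. v i)" by blast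
  next
    fix u v
    assume u: "u \<in> (\<Pi>\<^sub>E i \<in> I. V i) \<and> w = (\<Sum>i \<in> I. u i)"
      and v: "v \<in> (\<Pi>\<^sub>E i \<in> I. V i) \<and> w = (\<Sum>i \<in> I. v i)"
    have "u i - v i = 0" if "i \<in> I" for i
    proof (rule indep[of "\<lambda>i. u i - v i", OF _ _ that])
      show "u j - v j \<in> V j" if "j \<in> I" for j
        using u v that V(1) by (blast intro: cfun.subspace_diff)
      show "(\<Sum>i\<in>I. u i - v i) = 0" using u v by (simp only: sum_subtractf) simp
    qed
    then show "u = v" using u v by (intro PiE_ext[of u I V v]) auto
  qed
  with assms(1-4) show ?thesis unfolding direct_sum_def by blast
qed

lemma direct_sum_decompose:
  assumes "direct_sum W I V" "w \<in> W"
  obtains v where "\<And>i. i \<in> I \<Longrightarrow> v i \<in> V i" "w = (\<Sum>i\<in>I. v i)"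
proof -
  obtain v where "v \<in> (\<Pi>\<^sub>E i \<in> I. V i)" "w = (\<Sum>i\<in>I. v i)"
    using assms unfolding direct_sum_def by blast
  then show thesis using that by (auto simp: PiE_iff)
qed

lemma direct_sum_zero:
  assumes ds: "direct_sum W I V" and v: "\<And>i. i \<in> I \<Longrightarrow> v i \<in> V i"
    and z: "(\<Sum>i\<in>I. v i) = 0" and i: "i \<in> I"
  shows "v i = 0"
proof -
  have "0 \<in> W" using ds cfun.subspace_0 unfolding direct_sum_def by blast
  then have "\<exists>!v. v \<in> (\<Pi>\<^sub>E i \<in> I. V i) \<and> 0 = (\<Sum>i \<in> I. v i)"
    using ds unfolding direct_sum_def by blast
  moreover have "restrict v I \<in> (\<Pi>\<^sub>E i \<in> I. V i) \<and> 0 = (\<Sum>i \<in> I. restrict v I i)"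
    using v z by auto
  moreover have "restrict (\<lambda>_. 0) I \<in> (\<Pi>\<^sub>E i \<in> I. V i) \<and> 0 = (\<Sum>i \<in> I. restrict (\<lambda>_. 0) I i)"
    using ds cfun.subspace_0 unfolding direct_sum_def by auto
  ultimately have "restrict v I = restrict (\<lambda>_. 0) I" by blast
  then show ?thesis using i by (metis restrict_apply)
qed

text \<open>The family with \<open>x\<close> at \<open>i\<close>, \<open>- x\<close> at
  \<open>j\<close> and zero elsewhere sums to zero, hence vanishes.\<close>

lemma direct_sum_disjoint:
  assumes ds: "direct_sum W I V" and ij: "i \<in> I" "j \<in> I" "i \<noteq> j" and x: "x \<in> V i" "x \<in> V j"
  shows "x = 0"
proof -
  let ?v = "\<lambda>k. if k = i then x else if k = j then - x else 0"
  have fin: "finite I" and sub: "\<And>k. k \<in> I \<Longrightarrow> cfun.subspace (V k)"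
    using ds unfolding direct_sum_def by auto
  have "?v k \<in> V k" if "k \<in> I" for k
    using x sub[OF that] cfun.subspace_neg cfun.subspace_0 by auto
  moreover have "(\<Sum>k\<in>I. ?v k) = 0"
  proof -
    have "(\<Sum>k\<in>I. ?v k) = (\<Sum>k\<in>I. (if k = i then x else 0) + (if k = j then - x else 0))"
      using ij(3) by (intro sum.cong) auto
    also have "\<dots> = 0" using fin ij by (simp only: sum.distrib sum.delta) simp
    finally show ?thesis .
  qed
  ultimately have "?v i = 0" using direct_sum_zero[OF ds, of ?v i] ij(1) by blast
  then show ?thesis by simp
qed

text \<open>The induction step for building a direct sum one summand at a time: in a relation
  summing to zero, the new component is minus an element of \<open>W\<close>, so it lies in
  \<open>U \<inter> W\<close>.\<close>

lemma direct_sum_insert: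
  assumes ds: "direct_sum W I V" and i: "i \<notin> I" and U: "cfun.subspace U" and UW: "U \<inter> W \<subseteq> {0}"
  shows "direct_sum (cfun.span (W \<union> U)) (insert i I) (V(i := U))"
proof (rule direct_sumI)
  have fin: "finite I" and W: "cfun.subspace W"
    and V: "\<And>k. k \<in> I \<Longrightarrow> cfun.subspace (V k) \<and> V k \<subseteq> W"
    using ds unfolding direct_sum_def by auto
  show "finite (insert i I)" using fin by simp
  show "cfun.subspace (cfun.span (W \<union> U))" by simp
  show "cfun.subspace ((V(i := U)) k)" if "k \<in> insert i I" for k
    using that V U by auto
  show "(V(i := U)) k \<subseteq> cfun.span (W \<union> U)" if "k \<in> insert i I" for k
    using that V cfun.span_superset[of "W \<union> U"] by (auto split: if_splits)
  have sum_eq: "(\<Sum>k\<in>insert i I. v k) = v i + (\<Sum>k\<in>I. v k)" for v :: "'b \<Rightarrow> 'a \<Rightarrow> complex"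
    using fin i by simp
  show "\<exists>v. (\<forall>k\<in>insert i I. v k \<in> (V(i := U)) k) \<and> w = (\<Sum>k\<in>insert i I. v k)"
    if w: "w \<in> cfun.span (W \<union> U)" for w
  proof -
    have "w \<in> {x + y |x y. x \<in> W \<and> y \<in> U}"
      using w W U by (simp add: cfun.span_Un cfun.span_eq_iff[THEN iffD2])
    then obtain x y where xy: "x \<in> W" "y \<in> U" "w = x + y" by blast
    obtain v where v: "\<And>k. k \<in> I \<Longrightarrow> v k \<in> V k" "x = (\<Sum>k\<in>I. v k)"
      using direct_sum_decompose[OF ds xy(1)] by blast
    have "(\<Sum>k\<in>I. (v(i := y)) k) = x" unfolding v(2) using i by (intro sum.cong) auto
    then have "w = (\<Sum>k\<in>insert i I. (v(i := y)) k)" unfolding sum_eq by (simp add: xy(3) add.commute)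
    moreover have "\<forall>k\<in>insert i I. (v(i := y)) k \<in> (V(i := U)) k" using v(1) xy(2) by auto
    ultimately show ?thesis by blast
  qed
  show "v k = 0" if v: "\<And>k. k \<in> insert i I \<Longrightarrow> v k \<in> (V(i := U)) k"
    and z: "(\<Sum>k\<in>insert i I. v k) = 0" and k: "k \<in> insert i I" for v k
  proof -
    have vI: "v j \<in> V j" if "j \<in> I" for j using v[of j] that i by (auto split: if_splits)
    have "(\<Sum>k\<in>I. v k) \<in> W" by (intro cfun.subspace_sum[OF W]) (use V vI in blast)
    moreover have vi: "v i = - (\<Sum>k\<in>I. v k)" using z unfolding sum_eq by (simp add: eq_neg_iff_add_eq_0)
    ultimately have "v i \<in> W" using cfun.subspace_neg[OF W] by auto
    moreover have "v i \<in> U" using v[of i] by simp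
    ultimately have "v i = 0" using UW by blast
    moreover have "v j = 0" if "j \<in> I" for j
      using direct_sum_zero[OF ds vI _ that] vi \<open>v i = 0\<close> by simp
    ultimately show ?thesis using k by auto
  qed
qed

text \<open>The ambient space of all functions may be infinite-dimensional; the finite spanning set
  \<open>T\<close> keeps the bases finite. A basis of \<open>U\<close> extends to one of
  \<open>W\<close>, properly, since otherwise \<open>W\<close> would lie in
  \<open>U\<close>.\<close>

lemma dim_strict_mono:
  assumes T: "finite T" and U: "cfun.subspace U" and UW: "U \<subset> W" and W: "W \<subseteq> cfun.span T"
  shows "cfun.dim U < cfun.dim W"
proof -
  obtain A where A: "A \<subseteq> U" "cfun.independent A" "U \<subseteq> cfun.span A" "card A = cfun.dim U"
    using cfun.basis_exists by blast
  obtain B where B: "A \<subseteq> B" "B \<subseteq> W" "cfun.independent B" "W \<subseteq> cfun.span B"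
    using cfun.maximal_independent_subset_extend[of A W] A UW by blast
  have "finite B" using cfun.independent_span_bound[OF T B(3)] B(2) W by blast
  moreover have "A \<noteq> B" using A B UW cfun.span_minimal[OF A(1) U] by auto
  ultimately have "card A < card B" using B(1) by (intro psubset_card_mono) auto
  then show ?thesis using A(4) cfun.basis_card_eq_dim[OF B(2,4,3)] by simp
qed

text \<open>Take a subspace of least dimension among those with \<open>P\<close> inside
  \<open>S\<close>.\<close>

lemma exists_minimal_subspace:
  assumes T: "finite T" and S: "P S" "S \<subseteq> cfun.span T" and sub: "\<And>U. P U \<Longrightarrow> cfun.subspace U"
  obtains M where "P M" "M \<subseteq> S" "\<And>N. P N \<Longrightarrow> N \<subseteq> M \<Longrightarrow> N = M"
proof -
  have "P S \<and> S \<subseteq> S" using S by simp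
  from ex_has_least_nat[of "\<lambda>M. P M \<and> M \<subseteq> S" S cfun.dim, OF this]
  obtain M where M: "P M" "M \<subseteq> S" and least: "\<And>N. P N \<Longrightarrow> N \<subseteq> S \<Longrightarrow> cfun.dim M \<le> cfun.dim N"
    by blast
  have "N = M" if N: "P N" "N \<subseteq> M" for N
  proof (rule ccontr)
    assume "N \<noteq> M"
    then have "cfun.dim N < cfun.dim M"
      using dim_strict_mono[OF T sub[OF N(1)], of M] N M S by blast
    then show False using least[OF N(1)] N M by fastforce
  qed
  with M that show thesis by blast
qed

text \<open>Representations are linear only on their space, so \<open>f\<close> is assumed linear on
  \<open>W\<close> alone; the part of \<open>W\<close> that \<open>f\<close> sends into
  \<open>U\<close> is a subspace containing \<open>S\<close>.\<close>

lemma span_additive_closed: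
  assumes W: "cfun.subspace W" and S: "S \<subseteq> W"
    and add: "\<And>u v. u \<in> W \<Longrightarrow> v \<in> W \<Longrightarrow> f (u + v) = f u + f v"
    and scale: "\<And>c u. u \<in> W \<Longrightarrow> f (cscale c u) = cscale c (f u)"
    and U: "cfun.subspace U" "\<And>x. x \<in> S \<Longrightarrow> f x \<in> U" and x: "x \<in> cfun.span S"
  shows "f x \<in> U"
proof -
  have "cfun.span S \<subseteq> {x \<in> W. f x \<in> U}"
  proof (rule cfun.span_minimal)
    show "S \<subseteq> {x \<in> W. f x \<in> U}" using S U(2) by blast
    show "cfun.subspace {x \<in> W. f x \<in> U}"
    proof (rule cfun.subspaceI)
      have "f 0 = 0" using scale[of 0 0] cfun.subspace_0[OF W] by simp
      then show "0 \<in> {x \<in> W. f x \<in> U}" using cfun.subspace_0[OF W] cfun.subspace_0[OF U(1)] by simp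
    qed (auto simp: add scale cfun.subspace_add[OF W] cfun.subspace_scale[OF W]
        intro: cfun.subspace_add[OF U(1)] cfun.subspace_scale[OF U(1)])
  qed
  then show ?thesis using x by blast
qed

section \<open>Commuting representations\<close>

lemma is_rep_subspace: "is_rep G \<rho> W \<Longrightarrow> cfun.subspace W"
  by (simp add: is_rep_def)

lemma is_rep_closed: "is_rep G \<rho> W \<Longrightarrow> g \<in> carrier G \<Longrightarrow> w \<in> W \<Longrightarrow> \<rho> g w \<in> W"
  by (simp add: is_rep_def)

lemma is_rep_sub:
  assumes "is_rep G \<rho> W" "cfun.subspace U" "U \<subseteq> W" "\<And>g u. g \<in> carrier G \<Longrightarrow> u \<in> U \<Longrightarrow> \<rho> g u \<in> U"
  shows "is_rep G \<rho> U"
  using assms unfolding is_rep_def by (simp add: subset_iff)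

lemma is_rep_zero:
  assumes "is_rep G \<rho> W" "g \<in> carrier G" shows "\<rho> g 0 = 0"
proof -
  have "0 \<in> W" using assms(1) is_rep_subspace cfun.subspace_0 by blast
  then have "\<rho> g (cscale 0 0) = cscale 0 (\<rho> g 0)" using assms unfolding is_rep_def by blast
  then show ?thesis by simp
qed

lemma is_rep_sum:
  assumes "is_rep G \<rho> W" "g \<in> carrier G" "\<And>x. x \<in> A \<Longrightarrow> f x \<in> W"
  shows "\<rho> g (\<Sum>x\<in>A. f x) = (\<Sum>x\<in>A. \<rho> g (f x))"
  using assms(3)
proof (induction A rule: infinite_finite_induct)
  case (insert x A)
  then have "f x \<in> W" "(\<Sum>x\<in>A. f x) \<in> W"
    using cfun.subspace_sum[OF is_rep_subspace[OF assms(1)], of A f] by auto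
  then have "\<rho> g (f x + (\<Sum>x\<in>A. f x)) = \<rho> g (f x) + \<rho> g (\<Sum>x\<in>A. f x)"
    using assms(1,2) unfolding is_rep_def by blast
  then show ?case using insert by (simp del: plus_fun_apply)
qed (use is_rep_zero[OF assms(1,2)] in simp_all)

text \<open>
  The operators \<open>P i = \<Sum>\<^sub>g a\<^sub>i(g) \<rho>(g)\<close> are the central idempotents of the group algebra that
  project onto the summands. Since they are built from \<open>\<rho>\<close>, they commute with every intertwiner.
\<close>

locale commuting_reps = group G
  for G :: "('g, 'm) monoid_scheme" (structure) +
  fixes \<rho> \<sigma> :: "'g \<Rightarrow> ('b \<Rightarrow> complex) \<Rightarrow> ('b \<Rightarrow> complex)"
    and W :: "('b \<Rightarrow> complex) set" and I :: "'i set" and V :: "'i \<Rightarrow> ('b \<Rightarrow> complex) set"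
    and a :: "'i \<Rightarrow> 'g \<Rightarrow> complex" and T :: "('b \<Rightarrow> complex) set"
  assumes finite_carrier: "finite (carrier G)"
    and rep: "is_rep G \<rho> W" and rep': "is_rep G \<sigma> W"
    and commute: "\<And>g h w. g \<in> carrier G \<Longrightarrow> h \<in> carrier G \<Longrightarrow> w \<in> W \<Longrightarrow> \<rho> g (\<sigma> h w) = \<sigma> h (\<rho> g w)"
    and direct: "direct_sum W I V"
    and nonzero: "\<And>i. i \<in> I \<Longrightarrow> V i \<noteq> {0}"
    and stable: "\<And>i g v. i \<in> I \<Longrightarrow> g \<in> carrier G \<Longrightarrow> v \<in> V i \<Longrightarrow> \<rho> g v \<in> V i"
    and stable': "\<And>i g v. i \<in> I \<Longrightarrow> g \<in> carrier G \<Longrightarrow> v \<in> V i \<Longrightarrow> \<sigma> g v \<in> V i"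
    and minimal: "\<And>i U. i \<in> I \<Longrightarrow> cfun.subspace U \<Longrightarrow> U \<subseteq> V i \<Longrightarrow> U \<noteq> {0} \<Longrightarrow>
        (\<And>g u. g \<in> carrier G \<Longrightarrow> u \<in> U \<Longrightarrow> \<rho> g u \<in> U) \<Longrightarrow>
        (\<And>g u. g \<in> carrier G \<Longrightarrow> u \<in> U \<Longrightarrow> \<sigma> g u \<in> U) \<Longrightarrow> U = V i"
    and proj_in: "\<And>i w. i \<in> I \<Longrightarrow> w \<in> W \<Longrightarrow> (\<Sum>g\<in>carrier G. cscale (a i g) (\<rho> g w)) \<in> V i"
    and proj_sum: "\<And>w. w \<in> W \<Longrightarrow> (\<Sum>i\<in>I. \<Sum>g\<in>carrier G. cscale (a i g) (\<rho> g w)) = w"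
    and finite_T: "finite T" and W_span: "W \<subseteq> cfun.span T"
begin

section \<open>Projections onto the summands\<close>

definition P :: "'i \<Rightarrow> ('b \<Rightarrow> complex) \<Rightarrow> ('b \<Rightarrow> complex)" where
  "P i w = (\<Sum>g\<in>carrier G. cscale (a i g) (\<rho> g w))"

lemma finite_I: "finite I" and V_subspace: "i \<in> I \<Longrightarrow> cfun.subspace (V i)" and V_sub: "i \<in> I \<Longrightarrow> V i \<subseteq> W"
  using direct unfolding direct_sum_def by auto

lemma V_rep: "i \<in> I \<Longrightarrow> is_rep G \<rho> (V i)"
  using is_rep_sub[OF rep V_subspace V_sub] stable by blast

lemma P_closed:
  assumes "cfun.subspace U" "\<And>g u. g \<in> carrier G \<Longrightarrow> u \<in> U \<Longrightarrow> \<rho> g u \<in> U" "u \<in> U"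
  shows "P i u \<in> U"
  unfolding P_def using assms by (intro cfun.subspace_sum cfun.subspace_scale) auto

text \<open>For \<open>j \<noteq> i\<close> the vector \<open>P j v\<close> lies in
  \<open>V j\<close> by projection and in \<open>V i\<close> by stability, hence is zero; the
  projections of \<open>v\<close> sum to \<open>v\<close>, so only \<open>P i v\<close> is
  left.\<close>

lemma P_id:
  assumes i: "i \<in> I" and v: "v \<in> V i"
  shows "P i v = v"
proof -
  have vW: "v \<in> W" using V_sub i v by blast
  have "P j v = 0" if "j \<in> I" "j \<noteq> i" for j
    using direct_sum_disjoint[OF direct that(1) i that(2)] proj_in[OF that(1) vW]
      P_closed[OF V_subspace[OF i] stable[OF i] v] P_def by simp
  then have "(\<Sum>j\<in>I. P j v) = (\<Sum>j\<in>I. if j = i then P i v else 0)" by (intro sum.cong) auto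
  also have "\<dots> = P i v" using finite_I i by simp
  finally show ?thesis using proj_sum[OF vW] unfolding P_def by simp
qed

text \<open>The projections of a nonzero \<open>u \<in> U\<close> sum to \<open>u\<close>, so some
  \<open>P i u\<close> is nonzero. It lies in \<open>U\<close> as well as in \<open>V i\<close>, and
  irreducibility turns a nonzero intersection into inclusion.\<close>

lemma irreducible_in_V:
  assumes U: "irreducible_rep G \<rho> U" "U \<subseteq> W"
  obtains i where "i \<in> I" "U \<subseteq> V i"
proof -
  have Urep: "is_rep G \<rho> U" and "U \<noteq> {0}" using U(1) unfolding irreducible_rep_def by auto
  then obtain u where u: "u \<in> U" "u \<noteq> 0" using cfun.subspace_0[OF is_rep_subspace[OF Urep]] by blast
  have "(\<Sum>i\<in>I. P i u) = u" using proj_sum[of u] u U(2) unfolding P_def by blast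
  then obtain i where i: "i \<in> I" "P i u \<noteq> 0" using u(2) by (metis sum.neutral)
  have PU: "P i u \<in> U" using P_closed[OF is_rep_subspace[OF Urep] is_rep_closed[OF Urep] u(1)] .
  have PV: "P i u \<in> V i" unfolding P_def using proj_in i u U(2) by blast
  have "is_rep G \<rho> (U \<inter> V i)"
    by (rule is_rep_sub[OF Urep])
      (auto intro: cfun.subspace_inter is_rep_subspace[OF Urep] V_subspace is_rep_closed[OF Urep] stable i)
  then have "U \<inter> V i = {0} \<or> U \<inter> V i = U" using U(1) unfolding irreducible_rep_def by blast
  then have "U \<subseteq> V i" using PU PV i(2) by blast
  then show thesis using that i(1) by blast
qed

text \<open>An intertwiner commutes with \<open>P i\<close>. As \<open>P i\<close> fixes
  \<open>U\<close>, it also fixes the image of \<open>U\<close>, which therefore lies in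
  \<open>V i\<close>.\<close>

lemma iso_same_V:
  assumes i: "i \<in> I" and U: "U \<subseteq> V i" "is_rep G \<rho> U" and U': "U' \<subseteq> W"
    and iso: "rep_iso G \<rho> U \<rho> U'"
  shows "U' \<subseteq> V i"
proof
  fix u' assume "u' \<in> U'"
  obtain f where f: "bij_betw f U U'" "\<And>u v. u \<in> U \<Longrightarrow> v \<in> U \<Longrightarrow> f (u + v) = f u + f v"
    "\<And>c u. u \<in> U \<Longrightarrow> f (cscale c u) = cscale c (f u)"
    "\<And>g u. g \<in> carrier G \<Longrightarrow> u \<in> U \<Longrightarrow> f (\<rho> g u) = \<rho> g (f u)"
    using iso unfolding rep_iso_def by blast
  obtain u where u: "u \<in> U" "u' = f u" using f(1) \<open>u' \<in> U'\<close> unfolding bij_betw_def by blast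
  have sub: "cfun.subspace U" using U(2) is_rep_subspace by blast
  have f0: "f 0 = 0" using f(3)[of 0 0] cfun.subspace_0[OF sub] by simp
  \<comment> \<open>Membership in \<open>U\<close> is carried through the induction because
    \<open>f\<close> is additive only there.\<close>
  have fsum: "f (\<Sum>x\<in>A. h x) = (\<Sum>x\<in>A. f (h x)) \<and> (\<Sum>x\<in>A. h x) \<in> U"
    if "finite A" "\<And>x. x \<in> A \<Longrightarrow> h x \<in> U" for A :: "'g set" and h
    using that by (induction A) (auto simp: f0 f(2) cfun.subspace_0[OF sub] cfun.subspace_add[OF sub])
  have mem: "\<rho> g u \<in> U" if "g \<in> carrier G" for g using is_rep_closed[OF U(2) that u(1)] .
  have "u' = f (P i u)" using P_id[OF i] u U(1) by auto
  also have "\<dots> = (\<Sum>g\<in>carrier G. f (cscale (a i g) (\<rho> g u)))"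
    unfolding P_def
    by (rule conjunct1[OF fsum]) (use finite_carrier mem cfun.subspace_scale[OF sub] in auto)
  also have "\<dots> = P i u'"
    unfolding P_def u(2) using f(3,4) mem u(1) by (intro sum.cong) auto
  also have "\<dots> \<in> V i" unfolding P_def using proj_in[OF i] \<open>u' \<in> U'\<close> U' by blast
  finally show "u' \<in> V i" .
qed

section \<open>Translates of a subrepresentation under the commuting action\<close>

lemma translate_back:
  assumes "g \<in> carrier G" "w \<in> W"
  shows "\<sigma> (inv g) (\<sigma> g w) = w" "\<sigma> g (\<sigma> (inv g) w) = w"
proof -
  have "\<sigma> (inv g \<otimes> g) w = \<sigma> (inv g) (\<sigma> g w)" "\<sigma> (g \<otimes> inv g) w = \<sigma> g (\<sigma> (inv g) w)" "\<sigma> \<one> w = w"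
    using rep' assms inv_closed[OF assms(1)] unfolding is_rep_def by blast+
  then show "\<sigma> (inv g) (\<sigma> g w) = w" "\<sigma> g (\<sigma> (inv g) w) = w" using assms(1) by simp_all
qed

lemma translate_rep:
  assumes g: "g \<in> carrier G" and U: "is_rep G \<rho> U" "U \<subseteq> W"
  shows "is_rep G \<rho> (\<sigma> g ` U)" "\<sigma> g ` U \<subseteq> W"
proof -
  show sub: "\<sigma> g ` U \<subseteq> W" using is_rep_closed[OF rep' g] U by blast
  have sp: "cfun.subspace U" using U is_rep_subspace by blast
  have "cfun.subspace (\<sigma> g ` U)"
  proof (rule cfun.subspaceI)
    show "0 \<in> \<sigma> g ` U" using is_rep_zero[OF rep' g] cfun.subspace_0[OF sp] by (metis imageI)
    show "x + y \<in> \<sigma> g ` U" if xy: "x \<in> \<sigma> g ` U" "y \<in> \<sigma> g ` U" for x y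
    proof -
      obtain u v where "u \<in> U" "v \<in> U" "x = \<sigma> g u" "y = \<sigma> g v" using xy by blast
      moreover from this have "\<sigma> g (u + v) = x + y" using rep' g U(2) unfolding is_rep_def by blast
      ultimately show ?thesis using cfun.subspace_add[OF sp] by (metis imageI)
    qed
    show "cscale c x \<in> \<sigma> g ` U" if x: "x \<in> \<sigma> g ` U" for c x
    proof -
      obtain u where "u \<in> U" "x = \<sigma> g u" using x by blast
      moreover from this have "\<sigma> g (cscale c u) = cscale c x" using rep' g U(2) unfolding is_rep_def by blast
      ultimately show ?thesis using cfun.subspace_scale[OF sp] by (metis imageI)
    qed
  qed
  moreover have "\<rho> h x \<in> \<sigma> g ` U" if "h \<in> carrier G" "x \<in> \<sigma> g ` U" for h x
    using that commute[OF that(1) g] is_rep_closed[OF U(1)] U(2) by auto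
  ultimately show "is_rep G \<rho> (\<sigma> g ` U)" using is_rep_sub[OF rep _ sub] by blast
qed

text \<open>A subrepresentation of the translate is moved back by \<open>\<sigma> (inv g)\<close> to
  a subrepresentation of \<open>U\<close>, where irreducibility applies.\<close>

lemma translate_irreducible:
  assumes g: "g \<in> carrier G" and U: "irreducible_rep G \<rho> U" "U \<subseteq> W"
  shows "irreducible_rep G \<rho> (\<sigma> g ` U)"
proof -
  have Urep: "is_rep G \<rho> U" and "U \<noteq> {0}" using U(1) unfolding irreducible_rep_def by auto
  have z: "\<sigma> h ` {0} = {0}" if "h \<in> carrier G" for h using is_rep_zero[OF rep' that] by simp
  have cancel: "\<sigma> (inv g) ` \<sigma> g ` X = X" "\<sigma> g ` \<sigma> (inv g) ` X = X" if "X \<subseteq> W" for X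
    using that translate_back[OF g] by (force simp: image_image)+
  have "\<sigma> g ` U \<noteq> {0}" using cancel(1)[OF U(2)] z[of "inv g"] g \<open>U \<noteq> {0}\<close> by auto
  moreover have "N = {0} \<or> N = \<sigma> g ` U" if N: "N \<subseteq> \<sigma> g ` U" "is_rep G \<rho> N" for N
  proof -
    have NW: "N \<subseteq> W" using N(1) translate_rep(2)[OF g Urep U(2)] by blast
    have "is_rep G \<rho> (\<sigma> (inv g) ` N)" using translate_rep(1)[OF _ N(2) NW] g by simp
    moreover have "\<sigma> (inv g) ` N \<subseteq> U" using N(1) cancel(1)[OF U(2)] by blast
    ultimately have "\<sigma> (inv g) ` N = {0} \<or> \<sigma> (inv g) ` N = U"
      using U(1) unfolding irreducible_rep_def by blast
    then show ?thesis using cancel(2)[OF NW] z[OF g] by auto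
  qed
  ultimately show ?thesis
    unfolding irreducible_rep_def using translate_rep(1)[OF g Urep U(2)] by blast
qed

lemma translate_iso:
  assumes g: "g \<in> carrier G" and U: "is_rep G \<rho> U" "U \<subseteq> W"
  shows "rep_iso G \<rho> U \<rho> (\<sigma> g ` U)"
  unfolding rep_iso_def
proof (intro exI conjI allI ballI)
  have "inj_on (\<sigma> g) U" using translate_back(1)[OF g] U(2) by (intro inj_on_inverseI[of U "\<sigma> (inv g)"]) auto
  then show "bij_betw (\<sigma> g) U (\<sigma> g ` U)" unfolding bij_betw_def by blast
  fix u assume u: "u \<in> U"
  show "\<sigma> g (u + v) = \<sigma> g u + \<sigma> g v" if "v \<in> U" for v
    using rep' g u that U(2) unfolding is_rep_def by blast
  show "\<sigma> g (cscale c u) = cscale c (\<sigma> g u)" for c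
    using rep' g u U(2) unfolding is_rep_def by blast
  show "\<sigma> g (\<rho> h u) = \<rho> h (\<sigma> g u)" if "h \<in> carrier G" for h
    using commute[OF that g] u U(2) by auto
qed

text \<open>The operator \<open>\<sigma> (h \<otimes> inv g)\<close> carries one translate onto the
  other, so this is \<open>translate_iso\<close> applied to the translate by
  \<open>g\<close>.\<close>

lemma translates_iso:
  assumes gh: "g \<in> carrier G" "h \<in> carrier G" and U: "is_rep G \<rho> U" "U \<subseteq> W"
  shows "rep_iso G \<rho> (\<sigma> g ` U) \<rho> (\<sigma> h ` U)"
proof -
  have "\<sigma> (h \<otimes> inv g) (\<sigma> g u) = \<sigma> h u" if "u \<in> U" for u
  proof -
    have "u \<in> W" using that U(2) by blast
    then have "\<sigma> ((h \<otimes> inv g) \<otimes> g) u = \<sigma> (h \<otimes> inv g) (\<sigma> g u)"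
      using rep' gh unfolding is_rep_def by blast
    then show ?thesis using gh by (simp add: m_assoc)
  qed
  then have "\<sigma> (h \<otimes> inv g) ` \<sigma> g ` U = \<sigma> h ` U" by (force simp: image_image)
  then show ?thesis
    using translate_iso[OF _ translate_rep[OF gh(1) U], of "h \<otimes> inv g"] gh by simp
qed

section \<open>Isotypic summands and isotypic components\<close>

lemma exists_irreducible:
  assumes i: "i \<in> I"
  obtains U where "irreducible_rep G \<rho> U" "U \<subseteq> V i"
proof -
  let ?Q = "\<lambda>U. is_rep G \<rho> U \<and> U \<noteq> {0}"
  have "?Q (V i)" "V i \<subseteq> cfun.span T" using V_rep[OF i] nonzero[OF i] V_sub[OF i] W_span by auto
  then obtain U where U: "?Q U" "U \<subseteq> V i" "\<And>N. ?Q N \<Longrightarrow> N \<subseteq> U \<Longrightarrow> N = U"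
    by (rule exists_minimal_subspace[OF finite_T, of ?Q "V i"]) (auto intro: is_rep_subspace)
  then have "irreducible_rep G \<rho> U" unfolding irreducible_rep_def by blast
  with U(2) that show thesis by blast
qed

text \<open>The span is stable under \<open>\<sigma>\<close> because translates are permuted, and
  under \<open>\<rho>\<close> because the two actions commute. Minimality of \<open>V i\<close>
  under both actions then forces equality.\<close>

lemma span_translates:
  assumes i: "i \<in> I" and U: "irreducible_rep G \<rho> U" "U \<subseteq> V i"
  shows "cfun.span (\<Union>g\<in>carrier G. \<sigma> g ` U) = V i"
proof (rule minimal[OF i])
  let ?S = "cfun.span (\<Union>g\<in>carrier G. \<sigma> g ` U)"
  have Urep: "is_rep G \<rho> U" and "U \<noteq> {0}" using U(1) unfolding irreducible_rep_def by auto
  have UW: "U \<subseteq> W" using U(2) V_sub[OF i] by blast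
  show "cfun.subspace ?S" by simp
  show SV: "?S \<subseteq> V i" using stable'[OF i] U(2) V_subspace[OF i] by (intro cfun.span_minimal) auto
  have "U \<subseteq> ?S"
  proof
    fix u assume u: "u \<in> U"
    then have "\<sigma> \<one> u = u" using rep' UW unfolding is_rep_def by blast
    then have "u \<in> \<sigma> \<one> ` U" using u by (metis imageI)
    then show "u \<in> ?S" by (intro cfun.span_base UN_I[of \<one>]) auto
  qed
  then show "?S \<noteq> {0}" using \<open>U \<noteq> {0}\<close> cfun.subspace_0[OF is_rep_subspace[OF Urep]] by blast
  have gen: "(\<Union>g\<in>carrier G. \<sigma> g ` U) \<subseteq> W" using is_rep_closed[OF rep'] UW by blast
  note closed = span_additive_closed[OF is_rep_subspace[OF rep] gen _ _ cfun.subspace_span]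
  fix g x assume g: "g \<in> carrier G" and x: "x \<in> ?S"
  show "\<rho> g x \<in> ?S"
  proof (rule closed[OF _ _ _ x])
    fix y assume "y \<in> (\<Union>g\<in>carrier G. \<sigma> g ` U)"
    then obtain h u where hu: "h \<in> carrier G" "u \<in> U" "y = \<sigma> h u" by blast
    then have "\<rho> g y = \<sigma> h (\<rho> g u)" using commute[OF g, of h u] UW by auto
    then show "\<rho> g y \<in> ?S" using hu is_rep_closed[OF Urep g hu(2)] by (intro cfun.span_base) auto
  qed (use rep g in \<open>unfold is_rep_def, blast+\<close>)
  show "\<sigma> g x \<in> ?S"
  proof (rule closed[OF _ _ _ x])
    fix y assume "y \<in> (\<Union>g\<in>carrier G. \<sigma> g ` U)"
    then obtain h u where hu: "h \<in> carrier G" "u \<in> U" "y = \<sigma> h u" by blast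
    then have "\<sigma> g y = \<sigma> (g \<otimes> h) u" using rep' g UW unfolding is_rep_def by auto
    then have "\<sigma> g y \<in> \<sigma> (g \<otimes> h) ` U" using hu(2) by blast
    then show "\<sigma> g y \<in> ?S" using g hu(1) by (intro cfun.span_base) blast
  qed (use rep' g in \<open>unfold is_rep_def, blast+\<close>)
qed

text \<open>Translates are added one by one. Each is irreducible, so it either lies in the span
  already built and is skipped, or meets it in zero and becomes a new summand; \<open>n\<close> may
  thus be smaller than the size of \<open>F\<close>.\<close>

lemma translates_direct_sum:
  assumes U: "irreducible_rep G \<rho> U" "U \<subseteq> W" and F: "finite F" "F \<subseteq> carrier G"
  shows "\<exists>(n::nat) X. direct_sum (cfun.span (\<Union>g\<in>F. \<sigma> g ` U)) {..<n} X \<and>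
           (\<forall>k<n. \<exists>g\<in>carrier G. X k = \<sigma> g ` U)"
  using F
proof (induction F)
  case empty
  have "direct_sum (cfun.span {} :: ('b \<Rightarrow> complex) set) {..<0::nat} (\<lambda>_. {0})"
    by (rule direct_sumI) auto
  then show ?case by (intro exI[of _ "0::nat"] exI[of _ "\<lambda>_. {0}"]) simp
next
  case (insert g F)
  have Urep: "is_rep G \<rho> U" using U(1) unfolding irreducible_rep_def by auto
  have g: "g \<in> carrier G" using insert.prems by blast
  let ?S = "cfun.span (\<Union>g\<in>F. \<sigma> g ` U)" and ?N = "\<sigma> g ` U"
  obtain n X where X: "direct_sum ?S {..<n} X" "\<forall>k<(n::nat). \<exists>g\<in>carrier G. X k = \<sigma> g ` U"
    using insert.IH insert.prems by blast
  have Nirr: "irreducible_rep G \<rho> ?N" using translate_irreducible[OF g U] .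
  have Nrep: "is_rep G \<rho> ?N" using Nirr unfolding irreducible_rep_def by simp
  have Nsub: "cfun.subspace ?N" using is_rep_subspace[OF Nrep] .
  \<comment> \<open>Stability of the span makes its intersection with the new translate a
    subrepresentation of an irreducible one.\<close>
  have S_inv: "\<rho> h x \<in> ?S" if h: "h \<in> carrier G" and x: "x \<in> ?S" for h x
  proof -
    obtain v where v: "\<And>k. k \<in> {..<n} \<Longrightarrow> v k \<in> X k" "x = (\<Sum>k<n. v k)"
      using direct_sum_decompose[OF X(1) x] by blast
    have XW: "X k \<subseteq> W" "is_rep G \<rho> (X k)" if k: "k \<in> {..<n}" for k
    proof -
      obtain g' where "g' \<in> carrier G" "X k = \<sigma> g' ` U" using X(2) k by auto
      then show "X k \<subseteq> W" "is_rep G \<rho> (X k)" using translate_rep[OF _ Urep U(2)] by auto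
    qed
    then have "\<rho> h x = (\<Sum>k<n. \<rho> h (v k))"
      unfolding v(2) using v(1) by (intro is_rep_sum[OF rep h]) blast
    moreover have "\<rho> h (v k) \<in> ?S" if "k \<in> {..<n}" for k
      using is_rep_closed[OF XW(2)[OF that] h v(1)[OF that]] X(1) that
      unfolding direct_sum_def by blast
    ultimately show ?thesis by (auto intro: cfun.span_sum)
  qed
  have span_insert: "cfun.span (\<Union>g\<in>insert g F. \<sigma> g ` U) = cfun.span (?S \<union> ?N)"
    by (simp add: cfun.span_Un Un_commute cfun.span_span)
  have "is_rep G \<rho> (?N \<inter> ?S)"
  proof (rule is_rep_sub[OF Nrep])
    show "cfun.subspace (?N \<inter> ?S)" by (intro cfun.subspace_inter Nsub cfun.subspace_span)
    show "\<rho> h x \<in> ?N \<inter> ?S" if "h \<in> carrier G" "x \<in> ?N \<inter> ?S" for h x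
      using that S_inv is_rep_closed[OF Nrep] by blast
  qed simp
  then consider "?N \<inter> ?S = ?N" | "?N \<inter> ?S = {0}" using Nirr unfolding irreducible_rep_def by blast
  then show ?case
  proof cases
    case 1
    then have "cfun.span (?S \<union> ?N) = ?S" by (metis Int_lower2 Un_absorb2 cfun.span_span)
    then show ?thesis using X span_insert by auto
  next
    case 2
    then have "direct_sum (cfun.span (?S \<union> ?N)) (insert n {..<n}) (X(n := ?N))"
      by (intro direct_sum_insert[OF X(1) _ Nsub]) auto
    moreover have "\<forall>k<Suc n. \<exists>g\<in>carrier G. (X(n := ?N)) k = \<sigma> g ` U"
      using X(2) g by (auto simp: less_Suc_eq)
    ultimately show ?thesis using span_insert by (metis lessThan_Suc)
  qed
qed

text \<open>All translates of one irreducible \<open>U\<close> span \<open>V i\<close>, and a direct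
  sum extracted from them consists of pairwise isomorphic pieces.\<close>

theorem V_isotypic:
  assumes i: "i \<in> I"
  shows "isotypic G \<rho> (V i)"
proof -
  obtain U where U: "irreducible_rep G \<rho> U" "U \<subseteq> V i" using exists_irreducible[OF i] .
  have Urep: "is_rep G \<rho> U" using U(1) unfolding irreducible_rep_def by auto
  have UW: "U \<subseteq> W" using U V_sub[OF i] by blast
  obtain n :: nat and X where X: "direct_sum (V i) {..<n} X" "\<And>k. k < n \<Longrightarrow> \<exists>g\<in>carrier G. X k = \<sigma> g ` U"
    using translates_direct_sum[OF U(1) UW finite_carrier] span_translates[OF i U] by auto
  have "n > 0"
  proof (rule ccontr)
    assume "\<not> n > 0"
    then have "v = 0" if "v \<in> V i" for v
      using direct_sum_decompose[OF X(1) that] by (metis gr0I lessThan_0 sum.empty)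
    then show False using nonzero[OF i] cfun.subspace_0[OF V_subspace[OF i]] by blast
  qed
  moreover have "irreducible_rep G \<rho> (X k)" if "k < n" for k
    using X(2)[OF that] translate_irreducible[OF _ U(1) UW] by auto
  moreover have "rep_iso G \<rho> (X k) \<rho> (X l)" if "k < n" "l < n" for k l
    using X(2)[OF that(1)] X(2)[OF that(2)] translates_iso[OF _ _ Urep UW] by auto
  ultimately show ?thesis unfolding isotypic_def using V_rep[OF i] X(1) by blast
qed

text \<open>Copies of \<open>U\<close> cannot leave \<open>V i\<close> by \<open>iso_same_V\<close>,
  while the translates of \<open>U\<close> are copies that already span \<open>V i\<close>.\<close>

lemma component_eq_V:
  assumes i: "i \<in> I" and U: "irreducible_rep G \<rho> U" "U \<subseteq> V i"
  shows "isotypic_component G \<rho> W U = V i"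
proof
  have Urep: "is_rep G \<rho> U" using U(1) unfolding irreducible_rep_def by auto
  have UW: "U \<subseteq> W" using U V_sub[OF i] by blast
  show "isotypic_component G \<rho> W U \<subseteq> V i"
    unfolding isotypic_component_def using iso_same_V[OF i U(2) Urep] V_subspace[OF i]
    by (intro cfun.span_minimal) auto
  have "(\<Union>g\<in>carrier G. \<sigma> g ` U) \<subseteq> \<Union>{U'. U' \<subseteq> W \<and> irreducible_rep G \<rho> U' \<and> rep_iso G \<rho> U \<rho> U'}"
    using translate_irreducible[OF _ U(1) UW] translate_iso[OF _ Urep UW] translate_rep(2)[OF _ Urep UW]
    by blast
  then show "V i \<subseteq> isotypic_component G \<rho> W U"
    unfolding isotypic_component_def span_translates[OF i U, symmetric] by (rule cfun.span_mono)
qed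

text \<open>Distinct indices give distinct summands since these are nonzero and meet only in zero.
  Every irreducible lies in some \<open>V i\<close>, so every component is one of the
  summands.\<close>

theorem V_isotypic_decomposition: "isotypic_decomposition G \<rho> W I V"
proof -
  have "inj_on V I"
  proof (rule inj_onI, rule ccontr)
    fix i j assume ij: "i \<in> I" "j \<in> I" "V i = V j" "i \<noteq> j"
    then have "x = 0" if "x \<in> V i" for x using direct_sum_disjoint[OF direct ij(1,2,4)] that by auto
    then show False using nonzero[OF ij(1)] cfun.subspace_0[OF V_subspace[OF ij(1)]] by blast
  qed
  moreover have "V i \<in> isotypic_components G \<rho> W" if i: "i \<in> I" for i
  proof -
    obtain U where U: "irreducible_rep G \<rho> U" "U \<subseteq> V i" using exists_irreducible[OF i] .
    then show ?thesis
      using component_eq_V[OF i U] V_sub[OF i] unfolding isotypic_components_def by blast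
  qed
  moreover have "C \<in> V ` I" if C: "C \<in> isotypic_components G \<rho> W" for C
  proof -
    obtain U where U: "C = isotypic_component G \<rho> W U" "U \<subseteq> W" "irreducible_rep G \<rho> U"
      using C unfolding isotypic_components_def by blast
    obtain i where "i \<in> I" "U \<subseteq> V i" using irreducible_in_V[OF U(3,2)] .
    then show ?thesis using component_eq_V U by blast
  qed
  ultimately have "bij_betw V I (isotypic_components G \<rho> W)" unfolding bij_betw_def by blast
  then show ?thesis unfolding isotypic_decomposition_def using rep direct by blast
qed

end

section \<open>Characters of finite abelian groups\<close>

lemma (in group) sum_translate:
  assumes "h \<in> carrier G"
  shows "(\<Sum>g\<in>carrier G. f (h \<otimes> g)) = (\<Sum>g\<in>carrier G. f g)"
    "(\<Sum>g\<in>carrier G. f (g \<otimes> h)) = (\<Sum>g\<in>carrier G. f g)"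
proof -
  have "bij_betw (\<lambda>g. h \<otimes> g) (carrier G) (carrier G)"
    using assms by (intro bij_betwI[where g = "\<lambda>x. inv h \<otimes> x"]) (auto simp: m_assoc[symmetric])
  then show "(\<Sum>g\<in>carrier G. f (h \<otimes> g)) = (\<Sum>g\<in>carrier G. f g)" by (rule sum.reindex_bij_betw)
  have "bij_betw (\<lambda>g. g \<otimes> h) (carrier G) (carrier G)"
    using assms by (intro bij_betwI[where g = "\<lambda>x. x \<otimes> inv h"]) (auto simp: m_assoc)
  then show "(\<Sum>g\<in>carrier G. f (g \<otimes> h)) = (\<Sum>g\<in>carrier G. f g)" by (rule sum.reindex_bij_betw)
qed

lemma (in group) sum_inverse: "(\<Sum>g\<in>carrier G. f (inv g)) = (\<Sum>g\<in>carrier G. f g)"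
  by (rule sum.reindex_bij_betw, rule bij_betwI[where g = "\<lambda>x. inv x"]) auto

text \<open>Characters are extensional, hence \<open>undefined\<close> off the carrier; extending
  them by zero instead makes their span the space of functions supported on the carrier.\<close>

definition supported_char :: "('a, 'm) monoid_scheme \<Rightarrow> ('a \<Rightarrow> complex) \<Rightarrow> ('a \<Rightarrow> complex)" where
  "supported_char H \<chi> = (\<lambda>x. if x \<in> carrier H then \<chi> x else 0)"

section \<open>Orthogonality of characters\<close>

lemma unitary_characters_mult:
  assumes "\<chi> \<in> unitary_characters H" "x \<in> carrier H" "y \<in> carrier H"
  shows "\<chi> (x \<otimes>\<^bsub>H\<^esub> y) = \<chi> x * \<chi> y"
  using assms hom_mult[of \<chi> H circle_group x y] by (simp add: unitary_characters_def circle_group_def)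

lemma unitary_characters_norm:
  assumes "\<chi> \<in> unitary_characters H" "x \<in> carrier H"
  shows "cmod (\<chi> x) = 1"
  using assms hom_in_carrier[of \<chi> H circle_group x] by (simp add: unitary_characters_def circle_group_def)

lemma unitary_characters_cnj:
  assumes "\<chi> \<in> unitary_characters H" "x \<in> carrier H"
  shows "\<chi> x * cnj (\<chi> x) = 1"
  using unitary_characters_norm[OF assms] by (simp add: complex_norm_square[symmetric])

text \<open>If the characters differ at \<open>h\<close>, translating the summation by
  \<open>h\<close> multiplies the sum by \<open>\<chi> h * cnj (\<xi> h)\<close>, which is not 1, so
  the sum vanishes.\<close>

lemma sum_character_cnj:
  assumes H: "group H" and fin: "finite (carrier H)"
    and ch: "\<chi> \<in> unitary_characters H" "\<xi> \<in> unitary_characters H"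
  shows "(\<Sum>x\<in>carrier H. \<chi> x * cnj (\<xi> x)) = (if \<chi> = \<xi> then of_nat (order H) else 0)"
proof (cases "\<chi> = \<xi>")
  case True
  then show ?thesis using unitary_characters_cnj[OF ch(1)] by (simp add: order_def)
next
  case False
  interpret group H by fact
  obtain h where h: "h \<in> carrier H" "\<chi> h \<noteq> \<xi> h"
    using False ch extensionalityI[of \<chi> "carrier H" \<xi>] unfolding unitary_characters_def by blast
  let ?S = "\<Sum>x\<in>carrier H. \<chi> x * cnj (\<xi> x)"
  have "?S = (\<Sum>x\<in>carrier H. \<chi> (h \<otimes>\<^bsub>H\<^esub> x) * cnj (\<xi> (h \<otimes>\<^bsub>H\<^esub> x)))"
    using sum_translate(1)[OF h(1), of "\<lambda>x. \<chi> x * cnj (\<xi> x)"] by simp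
  also have "\<dots> = (\<Sum>x\<in>carrier H. (\<chi> h * cnj (\<xi> h)) * (\<chi> x * cnj (\<xi> x)))"
    using h(1) ch by (intro sum.cong) (simp_all add: unitary_characters_mult mult_ac)
  also have "\<dots> = (\<chi> h * cnj (\<xi> h)) * ?S" by (simp add: sum_distrib_left)
  finally have eq: "?S = (\<chi> h * cnj (\<xi> h)) * ?S" .
  have "\<chi> h * cnj (\<xi> h) \<noteq> 1"
  proof
    assume "\<chi> h * cnj (\<xi> h) = 1"
    then have "\<chi> h * (cnj (\<xi> h) * \<xi> h) = \<xi> h" by (metis mult.assoc mult_1)
    then show False using unitary_characters_cnj[OF ch(2) h(1)] h(2) by (simp add: mult.commute)
  qed
  then have "?S = 0" using eq by (metis mult_cancel_right1)
  then show ?thesis using False by simp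
qed

lemma sum_root_of_unity_powers:
  fixes n k :: nat
  defines "\<omega> \<equiv> cis (2 * pi / real n)"
  assumes k: "k < n"
  shows "(\<Sum>j<n. (\<omega> ^ k) ^ j) = (if k = 0 then of_nat n else 0)"
proof (cases "k = 0")
  case False
  have pow: "\<omega> ^ m = cis (2 * pi * real m / real n)" for m
    by (simp add: \<omega>_def DeMoivre mult_ac)
  have "inj_on (\<lambda>m. cis (2 * pi * real m / real n)) {..<n}"
    using bij_betw_roots_unity[of n] k unfolding bij_betw_def by simp
  from inj_onD[OF this, of k 0] have "\<omega> ^ k \<noteq> \<omega> ^ 0" using k False unfolding pow by auto
  then have "\<omega> ^ k \<noteq> 1" by simp
  moreover have "(\<omega> ^ k) ^ n = 1"
  proof -
    have "\<omega> ^ n = 1" using k by (simp add: pow)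
    then show ?thesis by (metis mult.commute power_mult power_one)
  qed
  ultimately show ?thesis using False by (simp add: geometric_sum)
qed simp

text \<open>
  Averaging \<open>f\<close> over the powers of \<open>g\<close> against the \<open>n\<close>-th roots of unity splits \<open>f\<close> into eigenvectors of
  translation by \<open>g\<close>; for commuting translations this does not destroy the eigenvector property
  already achieved. The joint eigenvectors of all translations are the multiples of characters.
\<close>

context comm_group
begin

definition joint_eigen :: "'a set \<Rightarrow> ('a \<Rightarrow> complex) set" where
  "joint_eigen S = {f. (\<forall>x. x \<notin> carrier G \<longrightarrow> f x = 0) \<and>
     (\<forall>g\<in>S. \<exists>c. \<forall>x\<in>carrier G. f (g \<otimes> x) = c * f x)}"

lemma joint_eigen_insert:
  assumes fin: "finite (carrier G)" and S: "S \<subseteq> carrier G" and g: "g \<in> carrier G"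
    and f: "f \<in> joint_eigen S"
  shows "f \<in> cfun.span (joint_eigen (insert g S))"
proof -
  define n where "n = order G"
  define \<omega> where "\<omega> = cis (2 * pi / real n)"
  \<comment> \<open>\<open>F j\<close> is the component of \<open>f\<close> with eigenvalue
    \<open>inverse (\<omega> ^ j)\<close> under translation by \<open>g\<close>. Taking the order of
    the group for \<open>n\<close>, rather than that of \<open>g\<close>, suffices since only
    \<open>g [^] n = \<one>\<close> matters.\<close>
  define F where "F j = (\<lambda>x. if x \<in> carrier G
     then 1 / of_nat n * (\<Sum>k<n. (\<omega> ^ j) ^ k * f (g [^] k \<otimes> x)) else 0)" for j :: nat
  have n0: "n > 0" using fin order_gt_0_iff_finite n_def by blast
  have gn: "g [^] n = \<one>" using pow_order_eq_1[OF g] n_def by simp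
  have \<omega>n: "\<omega> ^ n = 1" using n0 by (simp add: \<omega>_def DeMoivre)
  have \<omega>j: "(\<omega> ^ j) ^ n = 1" for j using \<omega>n by (metis mult.commute power_mult power_one)
  have F_in: "F j \<in> joint_eigen (insert g S)" for j
  proof -
    have "\<exists>c. \<forall>x\<in>carrier G. F j (h \<otimes> x) = c * F j x" if h: "h \<in> S" for h
    proof -
      obtain c where c: "\<And>x. x \<in> carrier G \<Longrightarrow> f (h \<otimes> x) = c * f x"
        using f h unfolding joint_eigen_def by blast
      have hc: "h \<in> carrier G" using h S by blast
      have "F j (h \<otimes> x) = c * F j x" if x: "x \<in> carrier G" for x
      proof -
        have "f (g [^] k \<otimes> (h \<otimes> x)) = c * f (g [^] k \<otimes> x)" for k :: nat
          using c[of "g [^] k \<otimes> x"] g hc x by (simp add: m_lcomm)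
        then show ?thesis using hc x by (simp add: F_def sum_distrib_left mult_ac)
      qed
      then show ?thesis by blast
    qed
    moreover have "F j (g \<otimes> x) = inverse (\<omega> ^ j) * F j x" if x: "x \<in> carrier G" for x
    proof -
      let ?t = "\<lambda>k. (\<omega> ^ j) ^ k * f (g [^] k \<otimes> x)"
      have "f (g [^] k \<otimes> (g \<otimes> x)) = f (g [^] Suc k \<otimes> x)" for k :: nat
        using g x by (simp add: m_assoc)
      then have "\<omega> ^ j * (\<Sum>k<n. (\<omega> ^ j) ^ k * f (g [^] k \<otimes> (g \<otimes> x))) = (\<Sum>k<n. ?t (Suc k))"
        by (simp add: sum_distrib_left mult_ac)
      \<comment> \<open>The shift wraps around: the term at \<open>n\<close> equals the term at
        0.\<close>
      also have "\<dots> = (\<Sum>k<n. ?t k)"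
        using sum.lessThan_Suc_shift[of ?t n] sum.lessThan_Suc[of ?t n] \<omega>j[of j] gn x by simp
      finally have "\<omega> ^ j * F j (g \<otimes> x) = F j x" using g x by (simp add: F_def mult_ac)
      moreover have "\<omega> ^ j \<noteq> 0" by (simp add: \<omega>_def)
      ultimately show ?thesis by (simp add: field_simps)
    qed
    ultimately show ?thesis unfolding joint_eigen_def by (auto simp: F_def)
  qed
  have "f = (\<Sum>j<n. F j)"
  proof
    fix x
    show "f x = (\<Sum>j<n. F j) x"
    proof (cases "x \<in> carrier G")
      case True
      have "(\<Sum>j<n. F j) x = (\<Sum>j<n. 1 / of_nat n * (\<Sum>k<n. (\<omega> ^ j) ^ k * f (g [^] k \<otimes> x)))"
        using True by (simp add: sum_fun_apply F_def)
      \<comment> \<open>After exchanging the sums, orthogonality of the roots of unity leaves only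
        \<open>k = 0\<close>.\<close>
      also have "\<dots> = 1 / of_nat n * (\<Sum>k<n. (\<Sum>j<n. (\<omega> ^ k) ^ j) * f (g [^] k \<otimes> x))"
        unfolding sum_distrib_left sum_distrib_right
        by (subst sum.swap) (simp add: power_mult[symmetric] mult.commute)
      also have "(\<Sum>k<n. (\<Sum>j<n. (\<omega> ^ k) ^ j) * f (g [^] k \<otimes> x))
          = (\<Sum>k<n. if k = 0 then of_nat n * f x else 0)"
        using True by (intro sum.cong) (auto simp: \<omega>_def sum_root_of_unity_powers)
      also have "\<dots> = of_nat n * f x" using n0 by simp
      finally show ?thesis using n0 by simp
    next
      case False
      then show ?thesis using f by (simp add: sum_fun_apply F_def joint_eigen_def)
    qed
  qed
  then show ?thesis using F_in by (metis cfun.span_base cfun.span_sum)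
qed

lemma span_joint_eigen:
  assumes fin: "finite (carrier G)" and S: "finite S" "S \<subseteq> carrier G"
    and f: "\<And>x. x \<notin> carrier G \<Longrightarrow> f x = 0"
  shows "f \<in> cfun.span (joint_eigen S)"
  using S
proof (induction S)
  case empty
  then show ?case using f by (intro cfun.span_base) (simp add: joint_eigen_def)
next
  case (insert g S)
  have "joint_eigen S \<subseteq> cfun.span (joint_eigen (insert g S))"
    using joint_eigen_insert[OF fin, of S g] insert.prems by blast
  then have "cfun.span (joint_eigen S) \<subseteq> cfun.span (joint_eigen (insert g S))"
    by (intro cfun.span_minimal cfun.subspace_span)
  then show ?case using insert by blast
qed

text \<open>The eigenvalue at \<open>x\<close> is read off at the unit:
  \<open>f x = c * f \<one>\<close>. Hence \<open>f\<close> is zero if \<open>f \<one> = 0\<close>,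
  and otherwise \<open>f / f \<one>\<close> is multiplicative.\<close>

lemma joint_eigen_carrier:
  assumes fin: "finite (carrier G)" and f: "f \<in> joint_eigen (carrier G)"
  shows "f \<in> cfun.span (supported_char G ` unitary_characters G)"
proof (cases "f \<one> = 0")
  case True
  have "f x = 0" for x
  proof (cases "x \<in> carrier G")
    case x: True
    then obtain c where "f (x \<otimes> \<one>) = c * f \<one>" using f unfolding joint_eigen_def by blast
    then show ?thesis using x True by simp
  qed (use f joint_eigen_def in auto)
  then have "f = 0" by (simp add: fun_eq_iff)
  then show ?thesis using cfun.span_zero by blast
next
  case False
  define \<chi> where "\<chi> = (\<lambda>x\<in>carrier G. f x / f \<one>)"
  have mult: "\<chi> (x \<otimes> y) = \<chi> x * \<chi> y" if xy: "x \<in> carrier G" "y \<in> carrier G" for x y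
  proof -
    obtain c where c: "\<And>z. z \<in> carrier G \<Longrightarrow> f (x \<otimes> z) = c * f z"
      using f xy unfolding joint_eigen_def by blast
    have "f x = c * f \<one>" using c[of \<one>] xy by simp
    then show ?thesis using c[OF xy(2)] xy False by (simp add: \<chi>_def field_simps)
  qed
  have pow: "\<chi> (x [^] k) = \<chi> x ^ k" if "x \<in> carrier G" for x and k :: nat
    using that by (induction k) (auto simp: mult, simp add: \<chi>_def False)
  \<comment> \<open>The values are roots of unity, because
    \<open>x [^] order G = \<one>\<close>.\<close>
  have "cmod (\<chi> x) = 1" if x: "x \<in> carrier G" for x
  proof -
    have "\<chi> x ^ order G = 1" using pow[OF x, of "order G"] pow_order_eq_1[OF x] False by (simp add: \<chi>_def)
    then have "cmod (\<chi> x) ^ order G = 1 ^ order G" by (metis norm_one norm_power power_one)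
    then show ?thesis using fin order_gt_0_iff_finite power_eq_iff_eq_base[of "order G" "cmod (\<chi> x)" 1] by simp
  qed
  then have "\<chi> \<in> unitary_characters G"
    unfolding unitary_characters_def circle_group_def hom_def using mult by (auto simp: \<chi>_def)
  moreover have "f = cscale (f \<one>) (supported_char G \<chi>)"
    using f False by (auto simp: fun_eq_iff cscale_apply supported_char_def \<chi>_def joint_eigen_def)
  ultimately show ?thesis by (metis cfun.span_base cfun.span_scale imageI)
qed

theorem span_characters:
  assumes fin: "finite (carrier G)" and f: "\<And>x. x \<notin> carrier G \<Longrightarrow> f x = 0"
  shows "f \<in> cfun.span (supported_char G ` unitary_characters G)"
proof -
  have "cfun.span (joint_eigen (carrier G)) \<subseteq> cfun.span (supported_char G ` unitary_characters G)"
    using joint_eigen_carrier[OF fin] by (intro cfun.span_minimal cfun.subspace_span) blast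
  then show ?thesis using span_joint_eigen[of "carrier G" f] fin f by auto
qed

end

section \<open>The group algebra and its regular representations\<close>

lemma group_algebra_carrier: "x \<in> carrier (group_algebra G) \<longleftrightarrow> (\<forall>g. g \<notin> carrier G \<longrightarrow> x g = 0)"
  by (simp add: group_algebra_def)

lemma group_algebra_simps [simp]:
  "mult (group_algebra G) = galg_mult G" "add (group_algebra G) = (+)"
  "zero (group_algebra G) = 0" "one (group_algebra G) = galg_basis \<one>\<^bsub>G\<^esub>"
  by (simp_all add: group_algebra_def)

lemma group_algebra_subspace: "cfun.subspace (carrier (group_algebra G))"
  by (rule cfun.subspaceI) (auto simp: group_algebra_carrier cscale_apply)

lemma group_algebra_span_basis:
  assumes "finite (carrier G)"
  shows "carrier (group_algebra G) \<subseteq> cfun.span (galg_basis ` carrier G)"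
proof
  fix x assume x: "x \<in> carrier (group_algebra G)"
  have "x = (\<Sum>g\<in>carrier G. cscale (x g) (galg_basis g))"
    using x assms by (auto simp: fun_eq_iff sum_fun_apply cscale_apply galg_basis_def group_algebra_carrier
        if_distrib[of "(*) _"] cong: if_cong)
  also have "\<dots> \<in> cfun.span (galg_basis ` carrier G)"
    by (intro cfun.span_sum cfun.span_scale cfun.span_base) auto
  finally show "x \<in> cfun.span (galg_basis ` carrier G)" .
qed

locale finite_group = group +
  assumes finite_carrier: "finite (carrier G)"
begin

text \<open>The product is convolution: for fixed \<open>g\<close> only
  \<open>h = inv g \<otimes> z\<close> contributes to the coefficient at \<open>z\<close>.\<close>

lemma galg_mult_apply:
  "galg_mult G x y z = (if z \<in> carrier G then \<Sum>g\<in>carrier G. x g * y (inv g \<otimes> z) else 0)"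
proof -
  have "(\<Sum>h\<in>carrier G. x g * y h * galg_basis (g \<otimes> h) z)
      = (if z \<in> carrier G then x g * y (inv g \<otimes> z) else 0)" if g: "g \<in> carrier G" for g
  proof -
    have "x g * y h * galg_basis (g \<otimes> h) z
        = (if h = inv g \<otimes> z then if z \<in> carrier G then x g * y (inv g \<otimes> z) else 0 else 0)"
      if "h \<in> carrier G" for h
      using g that by (auto simp: galg_basis_def m_assoc[symmetric])
    then have "(\<Sum>h\<in>carrier G. x g * y h * galg_basis (g \<otimes> h) z) = (\<Sum>h\<in>carrier G.
        if h = inv g \<otimes> z then if z \<in> carrier G then x g * y (inv g \<otimes> z) else 0 else 0)"
      by (intro sum.cong) auto
    then show ?thesis using finite_carrier g by simp
  qed
  then show ?thesis by (auto simp: galg_mult_def sum_fun_apply cscale_apply)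
qed

lemma galg_mult_apply':
  assumes z: "z \<in> carrier G"
  shows "galg_mult G x y z = (\<Sum>h\<in>carrier G. x (z \<otimes> inv h) * y h)"
proof -
  let ?f = "\<lambda>g. x g * y (inv g \<otimes> z)"
  have "galg_mult G x y z = (\<Sum>g\<in>carrier G. ?f (z \<otimes> inv g))"
    using z sum_inverse[of "\<lambda>g. ?f (z \<otimes> g)"] sum_translate(1)[of z ?f] by (simp add: galg_mult_apply)
  also have "\<dots> = (\<Sum>g\<in>carrier G. x (z \<otimes> inv g) * y g)"
    using z by (intro sum.cong) (auto simp: inv_mult_group m_assoc)
  finally show ?thesis .
qed

lemma galg_mult_closed: "galg_mult G x y \<in> carrier (group_algebra G)"
  by (simp add: group_algebra_carrier galg_mult_apply)

lemma galg_mult_assoc: "galg_mult G (galg_mult G x y) z = galg_mult G x (galg_mult G y z)"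
proof
  fix w
  show "galg_mult G (galg_mult G x y) z w = galg_mult G x (galg_mult G y z) w"
  proof (cases "w \<in> carrier G")
    case w: True
    have "galg_mult G (galg_mult G x y) z w
        = (\<Sum>h\<in>carrier G. \<Sum>g\<in>carrier G. x g * y (inv g \<otimes> h) * z (inv h \<otimes> w))"
      using w by (subst galg_mult_apply) (simp add: galg_mult_apply sum_distrib_right)
    also have "\<dots> = (\<Sum>g\<in>carrier G. \<Sum>h\<in>carrier G. x g * y (inv g \<otimes> h) * z (inv h \<otimes> w))"
      by (rule sum.swap)
    also have "\<dots> = (\<Sum>g\<in>carrier G. \<Sum>h\<in>carrier G. x g * y h * z (inv h \<otimes> (inv g \<otimes> w)))"
    proof (rule sum.cong[OF refl])
      fix g assume g: "g \<in> carrier G"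
      have "(\<Sum>h\<in>carrier G. x g * y (inv g \<otimes> h) * z (inv h \<otimes> w))
          = (\<Sum>h\<in>carrier G. x g * y (inv g \<otimes> (g \<otimes> h)) * z (inv (g \<otimes> h) \<otimes> w))"
        using sum_translate(1)[OF g, of "\<lambda>h. x g * y (inv g \<otimes> h) * z (inv h \<otimes> w)"] by simp
      also have "\<dots> = (\<Sum>h\<in>carrier G. x g * y h * z (inv h \<otimes> (inv g \<otimes> w)))"
        using g w by (intro sum.cong) (auto simp: m_assoc[symmetric] inv_mult_group)
      finally show "(\<Sum>h\<in>carrier G. x g * y (inv g \<otimes> h) * z (inv h \<otimes> w))
          = (\<Sum>h\<in>carrier G. x g * y h * z (inv h \<otimes> (inv g \<otimes> w)))" .
    qed
    also have "\<dots> = galg_mult G x (galg_mult G y z) w"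
      using w by (simp add: galg_mult_apply sum_distrib_left mult.assoc)
    finally show ?thesis .
  qed (simp add: galg_mult_apply)
qed

section \<open>Translations in coordinates and the ring structure\<close>

lemma left_regular_apply:
  assumes "g \<in> carrier G"
  shows "left_regular G g x z = (if z \<in> carrier G then x (inv g \<otimes> z) else 0)"
proof -
  have "(\<Sum>h\<in>carrier G. galg_basis g h * x (inv h \<otimes> z))
      = (\<Sum>h\<in>carrier G. if h = g then x (inv g \<otimes> z) else 0)"
    by (intro sum.cong) (auto simp: galg_basis_def)
  then show ?thesis using assms finite_carrier by (simp add: left_regular_def galg_mult_apply)
qed

lemma right_regular_apply:
  assumes "g \<in> carrier G"
  shows "right_regular G g x z = (if z \<in> carrier G then x (z \<otimes> g) else 0)"
proof (cases "z \<in> carrier G")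
  case True
  have "(\<Sum>h\<in>carrier G. x (z \<otimes> inv h) * galg_basis (inv g) h)
      = (\<Sum>h\<in>carrier G. if h = inv g then x (z \<otimes> g) else 0)"
    using assms by (intro sum.cong) (auto simp: galg_basis_def)
  then show ?thesis using True assms finite_carrier by (simp add: right_regular_def galg_mult_apply')
qed (simp add: right_regular_def galg_mult_apply)

text \<open>Multiplication by an algebra element is a combination of translations. This turns
  stability under translations into the ideal property, and central idempotents into operators built
  from the representation.\<close>

lemma galg_mult_left: "galg_mult G x y = (\<Sum>g\<in>carrier G. cscale (x g) (left_regular G g y))"
  by (auto simp: fun_eq_iff sum_fun_apply cscale_apply galg_mult_apply left_regular_apply)

text \<open>The inverse in the coefficient compensates for the inverse in
  \<open>right_regular\<close>.\<close>

lemma galg_mult_right: "galg_mult G x y = (\<Sum>g\<in>carrier G. cscale (y (inv g)) (right_regular G g x))"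
proof
  fix z
  have "(\<Sum>h\<in>carrier G. y (inv h) * x (z \<otimes> h)) = (\<Sum>h\<in>carrier G. y h * x (z \<otimes> inv h))"
    using sum_inverse[of "\<lambda>h. y (inv h) * x (z \<otimes> h)"] by (simp cong: sum.cong)
  then show "galg_mult G x y z = (\<Sum>g\<in>carrier G. cscale (y (inv g)) (right_regular G g x)) z"
    by (cases "z \<in> carrier G")
      (simp_all add: sum_fun_apply cscale_apply right_regular_apply galg_mult_apply' mult.commute,
        simp add: galg_mult_apply)
qed

lemma galg_mult_one_left: "x \<in> carrier (group_algebra G) \<Longrightarrow> galg_mult G (galg_basis \<one>) x = x"
  using left_regular_apply[of \<one> x] by (auto simp: left_regular_def group_algebra_carrier fun_eq_iff)

lemma galg_mult_one_right: "x \<in> carrier (group_algebra G) \<Longrightarrow> galg_mult G x (galg_basis \<one>) = x"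
  using right_regular_apply[of \<one> x] by (auto simp: right_regular_def group_algebra_carrier fun_eq_iff)

lemma galg_mult_add:
  "galg_mult G (x + y) z = galg_mult G x z + galg_mult G y z"
  "galg_mult G z (x + y) = galg_mult G z x + galg_mult G z y"
  by (auto simp: fun_eq_iff galg_mult_apply sum.distrib algebra_simps)

lemma galg_basis_one_closed: "galg_basis \<one> \<in> carrier (group_algebra G)"
  by (auto simp: galg_basis_def group_algebra_carrier)

lemma galg_mult_sum_left: "galg_mult G (\<Sum>i\<in>I. f i) x = (\<Sum>i\<in>I. galg_mult G (f i) x)"
  by (auto simp: fun_eq_iff sum_fun_apply galg_mult_apply sum_distrib_right intro: sum.swap)

lemma galg_mult_sum_right: "galg_mult G x (\<Sum>i\<in>I. f i) = (\<Sum>i\<in>I. galg_mult G x (f i))"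
  by (auto simp: fun_eq_iff sum_fun_apply galg_mult_apply sum_distrib_left intro: sum.swap)

lemma group_algebra_ring: "ring (group_algebra G)"
proof (rule ringI)
  show "abelian_group (group_algebra G)"
  proof (rule abelian_groupI)
    fix x assume "x \<in> carrier (group_algebra G)"
    then have "- x \<in> carrier (group_algebra G)" "- x + x = 0"
      by (simp_all add: group_algebra_carrier)
    then show "\<exists>y\<in>carrier (group_algebra G). y \<oplus>\<^bsub>group_algebra G\<^esub> x = \<zero>\<^bsub>group_algebra G\<^esub>"
      unfolding group_algebra_simps by blast
  qed (auto simp: group_algebra_carrier add.commute add.assoc)
  show "Group.monoid (group_algebra G)"
    by (rule monoidI)
      (simp_all add: galg_mult_closed galg_mult_assoc galg_mult_one_left galg_mult_one_right
        galg_basis_one_closed)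
qed (simp_all add: galg_mult_add)

section \<open>The regular representations and two-sided ideals\<close>

lemma left_regular_rep: "is_rep G (left_regular G) (carrier (group_algebra G))"
  unfolding is_rep_def
  by (intro conjI ballI allI group_algebra_subspace)
    (auto simp: fun_eq_iff left_regular_apply group_algebra_carrier cscale_apply m_assoc inv_mult_group)

lemma right_regular_rep: "is_rep G (right_regular G) (carrier (group_algebra G))"
  unfolding is_rep_def
  by (intro conjI ballI allI group_algebra_subspace)
    (auto simp: fun_eq_iff right_regular_apply group_algebra_carrier cscale_apply m_assoc)

lemma left_right_commute:
  assumes "g \<in> carrier G" "h \<in> carrier G"
  shows "left_regular G g (right_regular G h x) = right_regular G h (left_regular G g x)"
  using assms by (auto simp: fun_eq_iff left_regular_apply right_regular_apply m_assoc)

lemma bistable_ideal: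
  assumes V: "cfun.subspace V" "V \<subseteq> carrier (group_algebra G)"
    and left: "\<And>g v. g \<in> carrier G \<Longrightarrow> v \<in> V \<Longrightarrow> left_regular G g v \<in> V"
    and right: "\<And>g v. g \<in> carrier G \<Longrightarrow> v \<in> V \<Longrightarrow> right_regular G g v \<in> V"
  shows "ideal V (group_algebra G)"
proof (rule idealI)
  interpret ring "group_algebra G" by (rule group_algebra_ring)
  show "ring (group_algebra G)" by (rule group_algebra_ring)
  show "subgroup V (add_monoid (group_algebra G))"
  proof (rule group.subgroupI[OF a_group])
    fix v assume v: "v \<in> V"
    have "- v \<in> carrier (group_algebra G)" "- v + v = 0"
      using v V(2) by (auto simp: group_algebra_carrier)
    then have "\<ominus>\<^bsub>group_algebra G\<^esub> v = - v" using minus_equality[of "- v" v] v V(2) by auto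
    then show "inv\<^bsub>add_monoid (group_algebra G)\<^esub> v \<in> V"
      using cfun.subspace_neg[OF V(1) v] by (simp add: a_inv_def)
  qed (use V cfun.subspace_0[OF V(1)] cfun.subspace_add[OF V(1)] in auto)
  fix v x assume v: "v \<in> V" and x: "x \<in> carrier (group_algebra G)"
  show "x \<otimes>\<^bsub>group_algebra G\<^esub> v \<in> V"
    using left v by (auto simp: galg_mult_left intro!: cfun.subspace_sum cfun.subspace_scale V(1))
  show "v \<otimes>\<^bsub>group_algebra G\<^esub> x \<in> V"
    using right v by (auto simp: galg_mult_right intro!: cfun.subspace_sum cfun.subspace_scale V(1))
qed

end

section \<open>The additive group of the Lie ring\<close>

lemma (in group) inv_cancel_left:
  assumes "x \<in> carrier G" "y \<in> carrier G"
  shows "inv x \<otimes> (x \<otimes> y) = y" "x \<otimes> (inv x \<otimes> y) = y"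
  using assms by (simp_all add: m_assoc[symmetric])

locale odd_class_2 = finite_group +
  assumes odd_order: "odd (order G)" and class_2: "comm_group (G Mod group_center G)"
begin

abbreviation Z :: "'a set" where "Z \<equiv> group_center G"

section \<open>The center\<close>

lemma center_closed: "z \<in> Z \<Longrightarrow> z \<in> carrier G"
  by (simp add: group_center_def)

lemma center_commute: "z \<in> Z \<Longrightarrow> g \<in> carrier G \<Longrightarrow> g \<otimes> z = z \<otimes> g"
  by (simp add: group_center_def)

lemma center_subgroup: "subgroup Z G"
proof (rule subgroupI)
  show "Z \<subseteq> carrier G" by (auto simp: group_center_def)
  have "\<one> \<in> Z" by (simp add: group_center_def)
  then show "Z \<noteq> {}" by blast
  fix a b assume a: "a \<in> Z" and b: "b \<in> Z"
  show "a \<otimes> b \<in> Z"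
  proof -
    have ab: "a \<in> carrier G" "b \<in> carrier G" using a b center_closed by auto
    have "a \<otimes> b \<otimes> g = g \<otimes> (a \<otimes> b)" if g: "g \<in> carrier G" for g
    proof -
      have "a \<otimes> b \<otimes> g = a \<otimes> (g \<otimes> b)" unfolding center_commute[OF b g] using ab g by (rule m_assoc)
      also have "\<dots> = g \<otimes> a \<otimes> b" unfolding center_commute[OF a g] using ab g by (simp add: m_assoc)
      also have "\<dots> = g \<otimes> (a \<otimes> b)" using g ab by (rule m_assoc)
      finally show ?thesis .
    qed
    then show ?thesis using ab by (simp add: group_center_def)
  qed
  have "inv a \<otimes> g = g \<otimes> inv a" if g: "g \<in> carrier G" for g
  proof -
    have ac: "a \<in> carrier G" using center_closed[OF a] .
    have "inv a \<otimes> g = inv a \<otimes> (g \<otimes> a) \<otimes> inv a" using ac g by (simp add: m_assoc)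
    also have "\<dots> = g \<otimes> inv a"
      unfolding center_commute[OF a g] using ac g by (simp add: m_assoc inv_cancel_left)
    finally show ?thesis .
  qed
  then show "inv a \<in> Z" using center_closed[OF a] by (simp add: group_center_def)
qed

lemma center_normal: "Z \<lhd> G"
proof (rule normalI[OF center_subgroup], rule ballI)
  fix x assume x: "x \<in> carrier G"
  have "h \<otimes> x = x \<otimes> h" if "h \<in> Z" for h using center_commute[OF that x] by (rule sym)
  then show "Z #> x = x <# Z" unfolding r_coset_def l_coset_def by (intro SUP_cong) auto
qed

lemma center_mult: "y \<in> Z \<Longrightarrow> z \<in> Z \<Longrightarrow> y \<otimes> z \<in> Z"
  using center_subgroup by (rule subgroup.m_closed)

lemma center_inv: "z \<in> Z \<Longrightarrow> inv z \<in> Z"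
  using center_subgroup by (rule subgroup.m_inv_closed)

lemma center_pow: "z \<in> Z \<Longrightarrow> z [^] (k::nat) \<in> Z"
  by (induction k) (auto simp: center_mult subgroup.one_closed[OF center_subgroup])

section \<open>Commutators and their bilinearity\<close>

definition comm :: "'a \<Rightarrow> 'a \<Rightarrow> 'a" where
  "comm x y = y \<otimes> x \<otimes> inv (x \<otimes> y)"

text \<open>\<open>comm x y\<close> is the factor by which \<open>y \<otimes> x\<close> differs from
  \<open>x \<otimes> y\<close>; these products have the same coset because the quotient by the
  center is abelian.\<close>

lemma comm_center:
  assumes x: "x \<in> carrier G" and y: "y \<in> carrier G"
  shows "comm x y \<in> Z"
proof -
  interpret N: normal Z G by (rule center_normal)
  interpret Q: comm_group "G Mod Z" by (rule class_2)
  have "Z #> x \<in> carrier (G Mod Z)" "Z #> y \<in> carrier (G Mod Z)"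
    using x y by (auto simp: carrier_FactGroup)
  then have "Z #> (y \<otimes> x) = Z #> (x \<otimes> y)"
    using Q.m_comm[of "Z #> x" "Z #> y"] x y by (simp add: N.rcos_sum)
  then have "y \<otimes> x \<in> Z #> (x \<otimes> y)" using x y rcos_self[OF _ center_subgroup, of "y \<otimes> x"] by simp
  then obtain z where "z \<in> Z" "y \<otimes> x = z \<otimes> (x \<otimes> y)" by (auto simp: r_coset_def)
  then show ?thesis using x y center_closed by (simp add: comm_def m_assoc[of z])
qed

lemma comm_closed: "x \<in> carrier G \<Longrightarrow> y \<in> carrier G \<Longrightarrow> comm x y \<in> carrier G"
  by (rule center_closed[OF comm_center])

lemma comm_swap: "x \<in> carrier G \<Longrightarrow> y \<in> carrier G \<Longrightarrow> y \<otimes> x = comm x y \<otimes> (x \<otimes> y)"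
  by (simp add: comm_def m_assoc)

lemma comm_unique:
  assumes "x \<in> carrier G" "y \<in> carrier G" "z \<in> carrier G" "y \<otimes> x = z \<otimes> (x \<otimes> y)"
  shows "comm x y = z"
  unfolding comm_def assms(4) using assms(1-3) by (simp add: m_assoc)

lemma center_left_commute: "z \<in> Z \<Longrightarrow> g \<in> carrier G \<Longrightarrow> h \<in> carrier G \<Longrightarrow> g \<otimes> (z \<otimes> h) = z \<otimes> (g \<otimes> h)"
  using center_commute[of z g] center_closed[of z] by (simp add: m_assoc[symmetric])

text \<open>Move \<open>x\<close> past one factor at a time. The commutators that appear are
  central, so they can be collected in front.\<close>

lemma comm_mult:
  assumes x: "x \<in> carrier G" and y: "y \<in> carrier G" and z: "z \<in> carrier G"
  shows "comm x (y \<otimes> z) = comm x y \<otimes> comm x z" "comm (y \<otimes> z) x = comm y x \<otimes> comm z x"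
proof -
  note cl = comm_closed[OF x y] comm_closed[OF x z] comm_closed[OF y x] comm_closed[OF z x]
  have "y \<otimes> z \<otimes> x = comm x z \<otimes> (y \<otimes> x \<otimes> z)"
    using x y z cl comm_swap[OF x z] center_left_commute[OF comm_center[OF x z] y]
    by (simp add: m_assoc)
  also have "\<dots> = comm x y \<otimes> comm x z \<otimes> (x \<otimes> (y \<otimes> z))"
    using x y z cl comm_swap[OF x y] center_commute[OF comm_center[OF x z] cl(1)]
    by (simp add: m_assoc center_left_commute[OF comm_center[OF x z]])
  finally show "comm x (y \<otimes> z) = comm x y \<otimes> comm x z"
    using x y z cl by (intro comm_unique) auto
  have "x \<otimes> (y \<otimes> z) = comm y x \<otimes> (y \<otimes> (x \<otimes> z))"
    using x y z cl comm_swap[OF y x] by (simp add: m_assoc[symmetric])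
  also have "\<dots> = comm y x \<otimes> comm z x \<otimes> (y \<otimes> z \<otimes> x)"
    using x y z cl comm_swap[OF z x] by (simp add: m_assoc center_left_commute[OF comm_center[OF z x]])
  finally show "comm (y \<otimes> z) x = comm y x \<otimes> comm z x"
    using x y z cl by (intro comm_unique) auto
qed

lemma comm_one: "x \<in> carrier G \<Longrightarrow> comm x \<one> = \<one>" "x \<in> carrier G \<Longrightarrow> comm \<one> x = \<one>"
  by (simp_all add: comm_def)

lemma comm_central:
  assumes "z \<in> Z" "x \<in> carrier G"
  shows "comm x z = \<one>" "comm z x = \<one>"
  using assms center_commute[OF assms] center_closed by (auto intro!: comm_unique)

lemma comm_pow:
  assumes "x \<in> carrier G" "y \<in> carrier G"
  shows "comm (x [^] (k::nat)) y = comm x y [^] k" "comm x (y [^] k) = comm x y [^] k"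
  using assms by (induction k) (auto simp: comm_one comm_mult)

lemma comm_inverse:
  assumes "x \<in> carrier G" "y \<in> carrier G"
  shows "comm y x = inv (comm x y)"
  using assms by (simp add: comm_def inv_mult_group m_assoc)

section \<open>Square roots in a group of odd order\<close>

definition sqrt_exp :: nat where "sqrt_exp = (order G + 1) div 2"

definition sqroot :: "'a \<Rightarrow> 'a" where "sqroot x = x [^] sqrt_exp"

lemma sqroot_closed [simp]: "x \<in> carrier G \<Longrightarrow> sqroot x \<in> carrier G"
  by (simp add: sqroot_def)

lemma sqroot_square:
  assumes "x \<in> carrier G"
  shows "sqroot x \<otimes> sqroot x = x"
proof -
  \<comment> \<open>Oddness makes the halving exact, and
    \<open>x [^] (order G + 1) = x\<close>.\<close>
  have "sqrt_exp + sqrt_exp = order G + 1" using odd_order unfolding sqrt_exp_def by presburger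
  then have "sqroot x \<otimes> sqroot x = x [^] (order G + 1)" using assms by (simp only: sqroot_def nat_pow_mult)
  then show ?thesis using assms pow_order_eq_1[OF assms] by simp
qed

lemma square_sqroot:
  assumes "x \<in> carrier G" shows "sqroot (x \<otimes> x) = x"
proof -
  have "(x \<otimes> x) [^] sqrt_exp = x [^] sqrt_exp \<otimes> x [^] sqrt_exp"
    using assms by (simp add: pow_mult_distrib)
  then show ?thesis using sqroot_square[OF assms] by (simp add: sqroot_def)
qed

lemma sqroot_inv: "x \<in> carrier G \<Longrightarrow> sqroot (inv x) = inv (sqroot x)"
  by (simp add: sqroot_def nat_pow_inv)

text \<open>The right-hand side squares to the conjugate of \<open>x\<close>, and square roots are
  unique.\<close>

lemma sqroot_conj:
  assumes g: "g \<in> carrier G" and x: "x \<in> carrier G"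
  shows "sqroot (g \<otimes> x \<otimes> inv g) = g \<otimes> sqroot x \<otimes> inv g"
proof -
  have "(g \<otimes> sqroot x \<otimes> inv g) \<otimes> (g \<otimes> sqroot x \<otimes> inv g) = g \<otimes> x \<otimes> inv g"
    using g x sqroot_square[OF x]
    by (simp add: m_assoc inv_cancel_left) (simp add: m_assoc[symmetric])
  then show ?thesis using square_sqroot[of "g \<otimes> sqroot x \<otimes> inv g"] g x by simp
qed

lemma sqroot_center_mult:
  assumes "y \<in> Z" "z \<in> Z" shows "sqroot (y \<otimes> z) = sqroot y \<otimes> sqroot z"
  using assms center_closed center_commute unfolding sqroot_def by (intro pow_mult_distrib) auto

lemma sqroot_center: "z \<in> Z \<Longrightarrow> sqroot z \<in> Z"
  by (simp add: sqroot_def center_pow)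

lemma half_eq_sqroot: "z \<in> Z \<Longrightarrow> half G z = sqroot z"
  unfolding half_def
  by (rule the_inv_into_f_eq)
    (auto simp: sqroot_square sqroot_center center_closed intro!: inj_onI, metis square_sqroot center_closed)

text \<open>
  With the addition of \<open>L(B)\<close> in the form \<open>x + y = \<surd>x y \<surd>x\<close>, the relations between the two group
  structures needed below are mere cancellations in \<open>B\<close>.
\<close>

definition ladd :: "'a \<Rightarrow> 'a \<Rightarrow> 'a" where "ladd x y = sqroot x \<otimes> y \<otimes> sqroot x"

lemma ladd_closed [simp]: "x \<in> carrier G \<Longrightarrow> y \<in> carrier G \<Longrightarrow> ladd x y \<in> carrier G"
  by (simp add: ladd_def)

text \<open>This is the product corrected by half a commutator. By bilinearity, moving
  \<open>sqroot x\<close> past \<open>y\<close> costs \<open>comm (sqroot x) y\<close>, the square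
  root of \<open>comm x y\<close>.\<close>

lemma ladd_comm_form:
  assumes x: "x \<in> carrier G" and y: "y \<in> carrier G"
  shows "ladd x y = sqroot (comm x y) \<otimes> (x \<otimes> y)"
proof -
  have "comm (sqroot x) y = sqroot (comm x y)" using x y by (simp add: sqroot_def comm_pow)
  moreover have "ladd x y = sqroot x \<otimes> (comm (sqroot x) y \<otimes> (sqroot x \<otimes> y))"
    using x y comm_swap[of "sqroot x" y] by (simp add: ladd_def m_assoc)
  moreover have "\<dots> = comm (sqroot x) y \<otimes> (sqroot x \<otimes> sqroot x \<otimes> y)"
    using x y comm_closed[of "sqroot x" y]
      center_left_commute[OF comm_center[of "sqroot x" y], of "sqroot x" "sqroot x \<otimes> y"]
    by (simp add: m_assoc)
  ultimately show ?thesis using sqroot_square[OF x] by simp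
qed

text \<open>Exchanging the arguments inverts the commutator \<open>c\<close>; from \<open>c\<close>
  in \<open>y \<otimes> x\<close> and the inverse of its root, one root of \<open>c\<close>
  remains.\<close>

lemma ladd_commute:
  assumes x: "x \<in> carrier G" and y: "y \<in> carrier G"
  shows "ladd x y = ladd y x"
proof -
  let ?c = "comm x y"
  have c: "?c \<in> carrier G" using comm_closed[OF x y] .
  have "ladd y x = inv (sqroot ?c) \<otimes> (?c \<otimes> (x \<otimes> y))"
    using x y comm_swap[OF x y] by (simp add: ladd_comm_form comm_inverse[OF x y] sqroot_inv c)
  also have "\<dots> = inv (sqroot ?c) \<otimes> (sqroot ?c \<otimes> sqroot ?c \<otimes> (x \<otimes> y))" by (simp add: sqroot_square c)
  also have "\<dots> = sqroot ?c \<otimes> (x \<otimes> y)"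
    using x y c by (simp add: m_assoc inv_cancel_left)
  finally show ?thesis using ladd_comm_form[OF x y] by simp
qed

text \<open>Both sides are the triple product times the square roots of the three pairwise
  commutators, as the central factors inside \<open>ladd\<close> do not affect commutators.\<close>

lemma ladd_assoc:
  assumes x: "x \<in> carrier G" and y: "y \<in> carrier G" and z: "z \<in> carrier G"
  shows "ladd (ladd x y) z = ladd x (ladd y z)"
proof -
  note cZ = comm_center[OF x y] comm_center[OF x z] comm_center[OF y z]
  note sZ = cZ[THEN sqroot_center]
  note cl = cZ[THEN center_closed] sZ[THEN center_closed]
  have "ladd (ladd x y) z = sqroot (comm (ladd x y) z) \<otimes> (ladd x y \<otimes> z)"
    using x y z by (simp add: ladd_comm_form[of "ladd x y"])
  also have "comm (ladd x y) z = comm x z \<otimes> comm y z"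
    using x y z cl by (simp add: ladd_comm_form comm_mult comm_central[OF sZ(1)])
  also have "sqroot (comm x z \<otimes> comm y z) \<otimes> (ladd x y \<otimes> z)
     = sqroot (comm x z) \<otimes> (sqroot (comm y z) \<otimes> (sqroot (comm x y) \<otimes> (x \<otimes> (y \<otimes> z))))"
    using x y z cl by (simp add: ladd_comm_form sqroot_center_mult cZ m_assoc)
  also have "\<dots> = sqroot (comm x y) \<otimes> (sqroot (comm x z) \<otimes> (x \<otimes> (sqroot (comm y z) \<otimes> (y \<otimes> z))))"
    using x y z cl by (simp add: center_left_commute[OF sZ(1)] center_left_commute[OF sZ(3) x])
  also have "\<dots> = sqroot (comm x y \<otimes> comm x z) \<otimes> (x \<otimes> ladd y z)"
    using x y z cl by (simp add: ladd_comm_form sqroot_center_mult cZ m_assoc)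
  also have "comm x y \<otimes> comm x z = comm x (ladd y z)"
    using x y z cl by (simp add: ladd_comm_form comm_mult comm_central[OF sZ(3)])
  also have "sqroot (comm x (ladd y z)) \<otimes> (x \<otimes> ladd y z) = ladd x (ladd y z)"
    using x y z by (simp add: ladd_comm_form[of x "ladd y z"])
  finally show ?thesis .
qed

text \<open>The section enters only through central factors \<open>z1\<close>, \<open>z2\<close>,
  \<open>z3\<close> relating its values to \<open>x\<close>, \<open>y\<close> and
  \<open>x \<otimes> y\<close>, and these cancel. The result is therefore independent of
  \<open>s\<close>.\<close>

lemma lie_add_eq_ladd:
  assumes s: "central_section G s" and x: "x \<in> carrier G" and y: "y \<in> carrier G"
  shows "lie_add (lie_ring_of G s) x y = ladd x y"
proof -
  interpret N: normal Z G by (rule center_normal)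
  have sec: "\<exists>z\<in>Z. s (C_part G b) = z \<otimes> b" if b: "b \<in> carrier G" for b
  proof -
    have "Z #> b \<in> carrier (G Mod Z)" using b by (simp add: carrier_FactGroup)
    then have "s (Z #> b) \<in> Z #> b" using s unfolding central_section_def by blast
    then show ?thesis unfolding C_part_def r_coset_def by blast
  qed
  obtain z1 where z1: "z1 \<in> Z" "s (C_part G x) = z1 \<otimes> x" using sec[OF x] by blast
  obtain z2 where z2: "z2 \<in> Z" "s (C_part G y) = z2 \<otimes> y" using sec[OF y] by blast
  have C: "C_part G x \<otimes>\<^bsub>G Mod Z\<^esub> C_part G y = C_part G (x \<otimes> y)"
    using x y by (simp add: C_part_def N.rcos_sum)
  have C': "C_part G y \<otimes>\<^bsub>G Mod Z\<^esub> C_part G x = C_part G (x \<otimes> y)"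
  proof -
    interpret Q: comm_group "G Mod Z" by (rule class_2)
    show ?thesis unfolding C[symmetric] using x y
      by (intro Q.m_comm) (auto simp: carrier_FactGroup C_part_def)
  qed
  obtain z3 where z3: "z3 \<in> Z" "s (C_part G (x \<otimes> y)) = z3 \<otimes> (x \<otimes> y)" using sec[of "x \<otimes> y"] x y by auto
  define c where "c = comm x y"
  \<comment> \<open>\<open>d\<close> is the cocycle value \<open>psi\<close> at the classes of
    \<open>x\<close> and \<open>y\<close>; in the opposite order it becomes
    \<open>d \<otimes> c\<close>, so their symmetrized half is
    \<open>d \<otimes> sqroot c\<close>.\<close>
  define d where "d = z1 \<otimes> z2 \<otimes> inv z3"
  have cZ: "c \<in> Z" using comm_center[OF x y] c_def by simp
  have dZ: "d \<in> Z" unfolding d_def using z1 z2 z3 by (simp add: center_mult center_inv)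
  note cl = z1(1)[THEN center_closed] z2(1)[THEN center_closed] z3(1)[THEN center_closed]
     cZ[THEN center_closed] dZ[THEN center_closed]
  have psi1: "psi G s (C_part G x) (C_part G y) = d"
  proof -
    have "psi G s (C_part G x) (C_part G y) = z1 \<otimes> x \<otimes> (z2 \<otimes> y) \<otimes> inv (z3 \<otimes> (x \<otimes> y))"
      by (simp only: psi_def C z1(2) z2(2) z3(2))
    also have "\<dots> = z1 \<otimes> z2 \<otimes> (x \<otimes> y) \<otimes> (inv (x \<otimes> y) \<otimes> inv z3)"
      using x y cl by (simp add: inv_mult_group[of z3 "x \<otimes> y"] m_assoc center_left_commute[OF z2(1)])
    also have "\<dots> = d" unfolding d_def using x y cl
      by (simp add: m_assoc inv_cancel_left inv_mult_group)
    finally show ?thesis .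
  qed
  have psi2: "psi G s (C_part G y) (C_part G x) = d \<otimes> c"
  proof -
    have "psi G s (C_part G y) (C_part G x) = z2 \<otimes> y \<otimes> (z1 \<otimes> x) \<otimes> inv (z3 \<otimes> (x \<otimes> y))"
      by (simp only: psi_def C' z1(2) z2(2) z3(2))
    also have "\<dots> = z1 \<otimes> z2 \<otimes> c \<otimes> (x \<otimes> y) \<otimes> (inv (x \<otimes> y) \<otimes> inv z3)"
      using x y cl comm_swap[OF x y] c_def
      by (simp add: inv_mult_group[of z3 "x \<otimes> y"] m_assoc center_left_commute[OF z1(1)])
    also have "\<dots> = z1 \<otimes> z2 \<otimes> (c \<otimes> inv z3)" using x y cl
      by (simp add: m_assoc inv_cancel_left inv_mult_group)
    also have "\<dots> = d \<otimes> c" unfolding d_def using cl center_commute[OF cZ, of "inv z3"] by (simp add: m_assoc)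
    finally show ?thesis .
  qed
  have phi: "phi G s (C_part G x) (C_part G y) = d \<otimes> sqroot c"
  proof -
    have "phi G s (C_part G x) (C_part G y) = sqroot (d \<otimes> (d \<otimes> c))"
      unfolding phi_def psi1 psi2 by (rule half_eq_sqroot) (simp add: center_mult dZ cZ)
    also have "\<dots> = sqroot (d \<otimes> d) \<otimes> sqroot c"
      using cl sqroot_center_mult[OF center_mult[OF dZ dZ] cZ] by (simp add: m_assoc)
    finally show ?thesis using square_sqroot cl by simp
  qed
  have A: "A_part G s b = inv z" if "z \<in> Z" "s (C_part G b) = z \<otimes> b" "b \<in> carrier G" for b z
    unfolding A_part_def that(2) using that(1,3) center_closed[OF that(1)]
    by (simp add: inv_mult_group m_assoc[symmetric])
  have "lie_add (lie_ring_of G s) x y = inv z1 \<otimes> inv z2 \<otimes> (d \<otimes> sqroot c) \<otimes> (z3 \<otimes> (x \<otimes> y))"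
    unfolding lie_ring_of_def by (simp del: mult_FactGroup add: A[OF z1 x] A[OF z2 y] phi C z3(2))
  also have "\<dots> = inv z1 \<otimes> inv z2 \<otimes> (z1 \<otimes> z2) \<otimes> inv z3 \<otimes> z3 \<otimes> (sqroot c \<otimes> (x \<otimes> y))"
    using x y cl center_left_commute[OF z3(1), of "sqroot c" "x \<otimes> y"]
    by (simp add: d_def m_assoc inv_cancel_left)
  also have "inv z1 \<otimes> inv z2 \<otimes> (z1 \<otimes> z2) = \<one>"
    using cl center_commute[OF z2(1), of z1] by (simp add: m_assoc inv_cancel_left)
  finally show ?thesis using x y cl ladd_comm_form[OF x y] by (simp add: c_def)
qed

end

section \<open>Coadjoint orbits and two-sided ideals\<close>

locale lie_ring_setup = odd_class_2 +
  fixes s :: "'a set \<Rightarrow> 'a" and L :: "'a lie_ring"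
  assumes central_section: "central_section G s"
  defines "L \<equiv> lie_ring_of G s"
begin

abbreviation A :: "'a monoid" where "A \<equiv> additive_group L"
abbreviation W :: "('a \<Rightarrow> complex) set" where "W \<equiv> carrier (group_algebra G)"
abbreviation X :: "('a \<Rightarrow> complex) \<Rightarrow> ('a \<Rightarrow> complex)" where "X \<equiv> X_char L"
abbreviation ip :: "('a \<Rightarrow> complex) \<Rightarrow> ('a \<Rightarrow> complex) \<Rightarrow> complex" where "ip \<equiv> galg_inner G"

section \<open>The additive group of the Lie ring and its characters\<close>

lemma carrier_A [simp]: "carrier A = carrier G" and one_A [simp]: "\<one>\<^bsub>A\<^esub> = \<one>"
  by (simp_all add: additive_group_def L_def lie_ring_of_def)

lemma carrier_L [simp]: "carrier L = carrier G"
  by (simp add: L_def lie_ring_of_def)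

lemma mult_A: "x \<in> carrier G \<Longrightarrow> y \<in> carrier G \<Longrightarrow> x \<otimes>\<^bsub>A\<^esub> y = ladd x y"
  by (simp add: additive_group_def L_def lie_add_eq_ladd[OF central_section])

lemma comm_group_A: "comm_group A"
proof (rule comm_groupI)
  fix x assume x: "x \<in> carrier A"
  have "ladd (inv x) x = inv (sqroot x) \<otimes> (sqroot x \<otimes> sqroot x) \<otimes> inv (sqroot x)"
    using x by (simp add: ladd_def sqroot_inv sqroot_square)
  also have "\<dots> = \<one>" using x by (simp add: m_assoc inv_cancel_left)
  finally have "inv x \<otimes>\<^bsub>A\<^esub> x = \<one>" using x by (simp add: mult_A)
  then show "\<exists>y\<in>carrier A. y \<otimes>\<^bsub>A\<^esub> x = \<one>\<^bsub>A\<^esub>" using x by auto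
  show "\<one>\<^bsub>A\<^esub> \<otimes>\<^bsub>A\<^esub> x = x" using x by (simp add: mult_A) (simp add: ladd_def sqroot_def)
qed (simp_all add: mult_A ladd_assoc, rule ladd_commute)

lemma char_ladd:
  "\<chi> \<in> lie_characters L \<Longrightarrow> x \<in> carrier G \<Longrightarrow> y \<in> carrier G \<Longrightarrow> \<chi> (ladd x y) = \<chi> x * \<chi> y"
  using unitary_characters_mult[of \<chi> A x y] by (simp add: mult_A)

lemma char_cnj: "\<chi> \<in> lie_characters L \<Longrightarrow> x \<in> carrier G \<Longrightarrow> \<chi> x * cnj (\<chi> x) = 1"
  using unitary_characters_cnj[of \<chi> A x] by simp

section \<open>The orthonormal basis\<close>

lemma X_apply: "X \<chi> x = (if x \<in> carrier G then \<chi> x else 0)"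
  using finite_carrier
  by (simp add: X_char_def sum_fun_apply cscale_apply galg_basis_def if_distrib[of "(*) _"] cong: if_cong)

lemma X_eq_supported_char: "X = supported_char A"
  by (auto simp: fun_eq_iff X_apply supported_char_def)

lemma X_in_W: "X \<chi> \<in> W"
  by (simp add: group_algebra_carrier X_apply)

lemma order_pos: "order G > 0"
  using finite_carrier order_gt_0_iff_finite by blast

lemma ip_X:
  assumes "\<chi> \<in> lie_characters L" "\<xi> \<in> lie_characters L"
  shows "ip (X \<chi>) (X \<xi>) = (if \<chi> = \<xi> then 1 else 0)"
proof -
  have "group A" using comm_group_A by (simp add: comm_group_def)
  moreover have "order A = order G" by (simp add: order_def)
  ultimately show ?thesis
    using sum_character_cnj[OF _ _ assms] finite_carrier order_pos by (simp add: galg_inner_def X_apply)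
qed

lemma inj_X: "inj_on X (lie_characters L)"
  by (rule inj_onI) (metis ip_X zero_neq_one)

lemma ip_add: "ip (x + y) z = ip x z + ip y z"
  by (simp add: galg_inner_def sum.distrib algebra_simps)

lemma ip_scale: "ip (cscale c x) z = c * ip x z"
  by (simp add: galg_inner_def cscale_apply sum_distrib_left mult_ac)

lemma ip_zero: "ip 0 z = 0"
  by (simp add: galg_inner_def)

lemma ip_sum: "ip (\<Sum>i\<in>I. f i) z = (\<Sum>i\<in>I. ip (f i) z)"
  by (induction I rule: infinite_finite_induct) (simp_all add: ip_zero ip_add del: plus_fun_apply zero_fun_apply)

lemma ip_subspace: "cfun.subspace {v. ip v z = 0}"
  by (rule cfun.subspaceI) (auto simp: ip_zero ip_add ip_scale simp del: plus_fun_apply)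

lemma span_X: "cfun.span (X ` lie_characters L) = W"
proof
  show "cfun.span (X ` lie_characters L) \<subseteq> W"
    using X_in_W by (intro cfun.span_minimal group_algebra_subspace) auto
  show "W \<subseteq> cfun.span (X ` lie_characters L)"
    using comm_group.span_characters[OF comm_group_A] finite_carrier
    by (auto simp: X_eq_supported_char group_algebra_carrier)
qed

lemma independent_X: "cfun.independent (X ` lie_characters L)"
proof
  assume "cfun.dependent (X ` lie_characters L)"
  then obtain S u v where S: "finite S" "S \<subseteq> X ` lie_characters L" "v \<in> S" "u v \<noteq> 0"
    "(\<Sum>w\<in>S. cscale (u w) w) = 0"
    unfolding cfun.dependent_explicit by blast
  have "ip w v = (if w = v then 1 else 0)" if w: "w \<in> S" for w
  proof -
    obtain \<chi> \<xi> where "\<chi> \<in> lie_characters L" "\<xi> \<in> lie_characters L" "w = X \<chi>" "v = X \<xi>"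
      using w S(2,3) by blast
    then show ?thesis using ip_X[of \<chi> \<xi>] inj_onD[OF inj_X, of \<chi> \<xi>] by auto
  qed
  then have "ip (\<Sum>w\<in>S. cscale (u w) w) v = (\<Sum>w\<in>S. if w = v then u v else 0)"
    unfolding ip_sum ip_scale by (intro sum.cong) auto
  then show False using S ip_zero by simp
qed

text \<open>Distinct characters give independent vectors in a space spanned by finitely many basis
  elements.\<close>

lemma finite_characters: "finite (lie_characters L)"
proof -
  have "X ` lie_characters L \<subseteq> cfun.span (galg_basis ` carrier G)"
    using X_in_W group_algebra_span_basis[OF finite_carrier] by blast
  from cfun.independent_span_bound[OF _ independent_X this] show ?thesis
    using finite_carrier inj_X finite_imageD by blast
qed

text \<open>The vectors equal to their own expansion form a subspace containing every
  \<open>X \<chi>\<close>, hence everything.\<close>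

lemma expansion:
  assumes "w \<in> W"
  shows "w = (\<Sum>\<chi>\<in>lie_characters L. cscale (ip w (X \<chi>)) (X \<chi>))"
proof -
  let ?E = "\<lambda>w. \<Sum>\<chi>\<in>lie_characters L. cscale (ip w (X \<chi>)) (X \<chi>)"
  have "w \<in> cfun.span (X ` lie_characters L)" using assms span_X by simp
  moreover have "cfun.span (X ` lie_characters L) \<subseteq> {w. ?E w = w}"
  proof (rule cfun.span_minimal)
    show "cfun.subspace {w. ?E w = w}"
    proof (rule cfun.subspaceI)
      show "0 \<in> {w. ?E w = w}" by (simp add: ip_zero)
    qed (simp_all add: ip_add ip_scale cfun.scale_left_distrib sum.distrib cfun.scale_sum_right[symmetric]
        cfun.scale_scale[symmetric] del: plus_fun_apply cfun.scale_scale)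
    have "?E (X \<chi>) = X \<chi>" if "\<chi> \<in> lie_characters L" for \<chi>
    proof -
      have "?E (X \<chi>) = (\<Sum>\<xi>\<in>lie_characters L. if \<xi> = \<chi> then X \<chi> else 0)"
        using that by (intro sum.cong) (auto simp: ip_X)
      then show ?thesis using that finite_characters by simp
    qed
    then show "X ` lie_characters L \<subseteq> {w. ?E w = w}" by blast
  qed
  ultimately show ?thesis by auto
qed

theorem orthonormal_X: "orthonormal_basis ip W (lie_characters L) X"
  unfolding orthonormal_basis_def using inj_X independent_X span_X ip_X by blast

section \<open>The coadjoint action and its orbits\<close>

lemma coAd_apply: "b \<in> carrier G \<Longrightarrow> l \<in> carrier G \<Longrightarrow> coAd G b \<chi> l = \<chi> (inv b \<otimes> l \<otimes> b)"
  by (simp add: coAd_def Ad_def)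

text \<open>Conjugation preserves products and square roots, hence the addition of the Lie ring; so
  the coadjoint action maps characters to characters.\<close>

lemma conj_ladd:
  assumes "b \<in> carrier G" "x \<in> carrier G" "y \<in> carrier G"
  shows "inv b \<otimes> ladd x y \<otimes> b = ladd (inv b \<otimes> x \<otimes> b) (inv b \<otimes> y \<otimes> b)"
  using assms sqroot_conj[of "inv b" x] by (simp add: ladd_def m_assoc inv_cancel_left)

lemma coAd_char:
  assumes b: "b \<in> carrier G" and \<chi>: "\<chi> \<in> lie_characters L"
  shows "coAd G b \<chi> \<in> lie_characters L"
proof -
  have "coAd G b \<chi> (x \<otimes>\<^bsub>A\<^esub> y) = coAd G b \<chi> x * coAd G b \<chi> y" if "x \<in> carrier G" "y \<in> carrier G" for x y
    using that b \<chi> by (simp add: mult_A coAd_apply conj_ladd char_ladd)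
  moreover have "cmod (coAd G b \<chi> x) = 1" if "x \<in> carrier G" for x
    using unitary_characters_norm[OF \<chi>] that b by (simp add: coAd_apply)
  moreover have "coAd G b \<chi> \<in> extensional (carrier G)" by (simp add: coAd_def)
  ultimately show ?thesis by (simp add: unitary_characters_def hom_def circle_group_def)
qed

lemma coAd_mult:
  assumes "g \<in> carrier G" "h \<in> carrier G"
  shows "coAd G (g \<otimes> h) \<chi> = coAd G g (coAd G h \<chi>)"
  using assms by (auto simp: coAd_def Ad_def fun_eq_iff restrict_def inv_mult_group m_assoc)

lemma coAd_one:
  assumes "\<chi> \<in> lie_characters L" shows "coAd G \<one> \<chi> = \<chi>"
  using assms by (intro extensionalityI[of _ "carrier G"])
    (auto simp: coAd_apply, auto simp: coAd_def unitary_characters_def)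

abbreviation orbs :: "('a \<Rightarrow> complex) set set" where "orbs \<equiv> coadjoint_orbits G L"

lemma orbits_sub: "\<Omega> \<in> orbs \<Longrightarrow> \<Omega> \<subseteq> lie_characters L"
  by (auto simp: coadjoint_orbits_def orbits_def orbit_def coAd_char)

lemma orbit_stable:
  assumes \<Omega>: "\<Omega> \<in> orbs" and \<chi>: "\<chi> \<in> \<Omega>" and g: "g \<in> carrier G"
  shows "coAd G g \<chi> \<in> \<Omega>"
proof -
  obtain \<xi> where \<xi>: "\<Omega> = {coAd G h \<xi> |h. h \<in> carrier G}"
    using \<Omega> unfolding coadjoint_orbits_def orbits_def orbit_def by blast
  then obtain h where "h \<in> carrier G" "\<chi> = coAd G h \<xi>" using \<chi> by blast
  then have "coAd G g \<chi> = coAd G (g \<otimes> h) \<xi>" "g \<otimes> h \<in> carrier G" using g by (simp_all add: coAd_mult)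
  then show ?thesis using \<xi> by blast
qed

lemma orbit_transitive:
  assumes \<Omega>: "\<Omega> \<in> orbs" and \<chi>: "\<chi> \<in> \<Omega>"
  shows "\<Omega> = orbit G (coAd G) \<chi>"
proof -
  obtain \<xi> where \<xi>: "\<Omega> = {coAd G h \<xi> |h. h \<in> carrier G}" "\<xi> \<in> lie_characters L"
    using \<Omega> unfolding coadjoint_orbits_def orbits_def orbit_def by blast
  then obtain h where h: "h \<in> carrier G" "\<chi> = coAd G h \<xi>" using \<chi> by blast
  have "coAd G g \<xi> \<in> orbit G (coAd G) \<chi>" if g: "g \<in> carrier G" for g
  proof -
    have "coAd G (g \<otimes> inv h) \<chi> = coAd G g \<xi>"
      using g h by (simp add: coAd_mult[symmetric] m_assoc)
    moreover have "g \<otimes> inv h \<in> carrier G" using g h by simp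
    ultimately show ?thesis unfolding orbit_def by force
  qed
  then have "\<Omega> \<subseteq> orbit G (coAd G) \<chi>" using \<xi>(1) by blast
  moreover have "orbit G (coAd G) \<chi> \<subseteq> \<Omega>" using orbit_stable[OF \<Omega> \<chi>] by (auto simp: orbit_def)
  ultimately show ?thesis by blast
qed

lemma orbit_nonempty: "\<Omega> \<in> orbs \<Longrightarrow> \<Omega> \<noteq> {}"
  unfolding coadjoint_orbits_def orbits_def orbit_def using one_closed by blast

lemma orbits_disjoint: "\<Omega> \<in> orbs \<Longrightarrow> \<Omega>' \<in> orbs \<Longrightarrow> \<Omega> \<noteq> \<Omega>' \<Longrightarrow> \<Omega> \<inter> \<Omega>' = {}"
  using orbit_transitive by blast

lemma orbits_Union: "\<Union>orbs = lie_characters L"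
proof
  show "\<Union>orbs \<subseteq> lie_characters L" using orbits_sub by blast
  show "lie_characters L \<subseteq> \<Union>orbs"
  proof
    fix \<chi> assume \<chi>: "\<chi> \<in> lie_characters L"
    have "coAd G \<one> \<chi> \<in> orbit G (coAd G) \<chi>" unfolding orbit_def using one_closed by blast
    moreover have "orbit G (coAd G) \<chi> \<in> orbs" unfolding coadjoint_orbits_def orbits_def using \<chi> by blast
    ultimately show "\<chi> \<in> \<Union>orbs" using coAd_one[OF \<chi>] by auto
  qed
qed

lemma finite_orbits: "finite orbs"
  using finite_characters orbits_Union finite_UnionD by metis

text \<open>In the Lie ring \<open>inv g \<otimes> z\<close> is the sum of \<open>inv g\<close> and
  the conjugate of \<open>z\<close> by \<open>inv (sqroot g)\<close>. The first summand gives the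
  scalar, the second the coadjoint action of \<open>sqroot g\<close>.\<close>

lemma left_regular_X:
  assumes g: "g \<in> carrier G" and \<chi>: "\<chi> \<in> lie_characters L"
  shows "left_regular G g (X \<chi>) = cscale (\<chi> (inv g)) (X (coAd G (sqroot g) \<chi>))"
proof
  fix z
  let ?k = "sqroot g"
  have "inv g \<otimes> z = ladd (inv g) (inv ?k \<otimes> z \<otimes> ?k)" if z: "z \<in> carrier G"
  proof -
    have "inv g = inv ?k \<otimes> inv ?k" using g sqroot_square[OF g] inv_mult_group[of ?k ?k] by simp
    moreover have "ladd (inv g) (inv ?k \<otimes> z \<otimes> ?k) = inv ?k \<otimes> inv ?k \<otimes> z"
      using g z by (simp add: ladd_def sqroot_inv m_assoc)
    ultimately show ?thesis by simp
  qed
  then have "\<chi> (inv g \<otimes> z) = \<chi> (inv g) * \<chi> (inv ?k \<otimes> z \<otimes> ?k)" if "z \<in> carrier G"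
    using that g char_ladd[OF \<chi>, of "inv g" "inv ?k \<otimes> z \<otimes> ?k"] by simp
  then show "left_regular G g (X \<chi>) z = cscale (\<chi> (inv g)) (X (coAd G ?k \<chi>)) z"
    using g by (simp add: left_regular_apply X_apply cscale_apply coAd_apply)
qed

text \<open>The same conjugate of \<open>z\<close>, now added to \<open>g\<close>, gives
  \<open>z \<otimes> g\<close>.\<close>

lemma right_regular_X:
  assumes g: "g \<in> carrier G" and \<chi>: "\<chi> \<in> lie_characters L"
  shows "right_regular G g (X \<chi>) = cscale (\<chi> g) (X (coAd G (sqroot g) \<chi>))"
proof
  fix z
  let ?k = "sqroot g"
  have "z \<otimes> g = ladd g (inv ?k \<otimes> z \<otimes> ?k)" if z: "z \<in> carrier G"
    using g z sqroot_square[OF g] by (simp add: ladd_def m_assoc inv_cancel_left)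
  then have "\<chi> (z \<otimes> g) = \<chi> g * \<chi> (inv ?k \<otimes> z \<otimes> ?k)" if "z \<in> carrier G"
    using that g char_ladd[OF \<chi>, of g "inv ?k \<otimes> z \<otimes> ?k"] by simp
  then show "right_regular G g (X \<chi>) z = cscale (\<chi> g) (X (coAd G ?k \<chi>)) z"
    using g by (simp add: right_regular_apply X_apply cscale_apply coAd_apply)
qed

section \<open>The ideals attached to the orbits, their direct sum and their minimality\<close>

abbreviation V :: "('a \<Rightarrow> complex) set \<Rightarrow> ('a \<Rightarrow> complex) set" where "V \<equiv> V_orbit L"

lemma V_subspace: "cfun.subspace (V \<Omega>)"
  by (simp add: V_orbit_def)

lemma V_sub_W: "V \<Omega> \<subseteq> W"
  unfolding V_orbit_def using X_in_W by (intro cfun.span_minimal group_algebra_subspace) auto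

lemma X_in_V: "\<chi> \<in> \<Omega> \<Longrightarrow> X \<chi> \<in> V \<Omega>"
  unfolding V_orbit_def by (intro cfun.span_base) simp

lemma rep_V_stable:
  assumes rep: "is_rep G \<rho> W" and g: "g \<in> carrier G" and v: "v \<in> V \<Omega>"
    and X: "\<And>\<chi>. \<chi> \<in> \<Omega> \<Longrightarrow> \<rho> g (X \<chi>) \<in> V \<Omega>"
  shows "\<rho> g v \<in> V \<Omega>"
proof (rule span_additive_closed[OF group_algebra_subspace[of G], where S = "X ` \<Omega>" and f = "\<rho> g" and x = v])
  show "X ` \<Omega> \<subseteq> W" using X_in_W by blast
  show "v \<in> cfun.span (X ` \<Omega>)" using v by (simp add: V_orbit_def)
qed (use rep g X V_subspace in \<open>auto simp: is_rep_def simp del: plus_fun_apply\<close>)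

lemma V_left_stable:
  assumes \<Omega>: "\<Omega> \<in> orbs" and g: "g \<in> carrier G" and v: "v \<in> V \<Omega>"
  shows "left_regular G g v \<in> V \<Omega>"
proof (rule rep_V_stable[OF left_regular_rep g v])
  fix \<chi> assume \<chi>: "\<chi> \<in> \<Omega>"
  then have "\<chi> \<in> lie_characters L" using orbits_sub[OF \<Omega>] by blast
  then show "left_regular G g (X \<chi>) \<in> V \<Omega>"
    using g X_in_V orbit_stable[OF \<Omega> \<chi>] by (simp add: left_regular_X cfun.subspace_scale[OF V_subspace])
qed

lemma V_right_stable:
  assumes \<Omega>: "\<Omega> \<in> orbs" and g: "g \<in> carrier G" and v: "v \<in> V \<Omega>"
  shows "right_regular G g v \<in> V \<Omega>"
proof (rule rep_V_stable[OF right_regular_rep g v])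
  fix \<chi> assume \<chi>: "\<chi> \<in> \<Omega>"
  then have "\<chi> \<in> lie_characters L" using orbits_sub[OF \<Omega>] by blast
  then show "right_regular G g (X \<chi>) \<in> V \<Omega>"
    using g X_in_V orbit_stable[OF \<Omega> \<chi>] by (simp add: right_regular_X cfun.subspace_scale[OF V_subspace])
qed

lemma V_ideal: "\<Omega> \<in> orbs \<Longrightarrow> ideal (V \<Omega>) (group_algebra G)"
  using bistable_ideal[OF V_subspace V_sub_W] V_left_stable V_right_stable by blast

lemma V_nonzero:
  assumes "\<Omega> \<in> orbs"
  shows "V \<Omega> \<noteq> {0}"
proof -
  obtain \<chi> where "\<chi> \<in> \<Omega>" "\<chi> \<in> lie_characters L"
    using orbit_nonempty[OF assms] orbits_sub[OF assms] by blast
  then have "X \<chi> \<in> V \<Omega>" "X \<chi> \<noteq> 0" using X_in_V ip_X[of \<chi> \<chi>] ip_zero by auto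
  then show ?thesis by blast
qed

lemma ip_V_outside:
  assumes \<Omega>: "\<Omega> \<in> orbs" and v: "v \<in> V \<Omega>" and \<chi>: "\<chi> \<in> lie_characters L" "\<chi> \<notin> \<Omega>"
  shows "ip v (X \<chi>) = 0"
proof -
  have "X ` \<Omega> \<subseteq> {v. ip v (X \<chi>) = 0}" using ip_X[OF _ \<chi>(1)] orbits_sub[OF \<Omega>] \<chi>(2) by auto
  then have "V \<Omega> \<subseteq> {v. ip v (X \<chi>) = 0}" unfolding V_orbit_def using ip_subspace by (rule cfun.span_minimal)
  then show ?thesis using v by blast
qed

text \<open>Grouping the orthonormal expansion by orbits gives existence. For independence, pairing
  a relation with \<open>X \<chi>\<close> isolates the summand whose orbit contains
  \<open>\<chi>\<close>.\<close>

lemma V_direct_sum: "direct_sum W orbs V"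
proof (rule direct_sumI)
  show "\<exists>v. (\<forall>\<Omega>\<in>orbs. v \<Omega> \<in> V \<Omega>) \<and> w = (\<Sum>\<Omega>\<in>orbs. v \<Omega>)" if w: "w \<in> W" for w
  proof (intro exI conjI ballI)
    let ?v = "\<lambda>\<Omega>. \<Sum>\<chi>\<in>\<Omega>. cscale (ip w (X \<chi>)) (X \<chi>)"
    show "?v \<Omega> \<in> V \<Omega>" for \<Omega>
      by (intro cfun.subspace_sum cfun.subspace_scale V_subspace X_in_V)
    have "\<forall>\<Omega>\<in>orbs. finite \<Omega>" using orbits_sub finite_characters finite_subset by blast
    moreover have "\<forall>\<Omega>\<in>orbs. \<forall>\<Omega>'\<in>orbs. \<Omega> \<noteq> \<Omega>' \<longrightarrow> \<Omega> \<inter> \<Omega>' = {}" using orbits_disjoint by blast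
    ultimately have "sum (\<lambda>\<chi>. cscale (ip w (X \<chi>)) (X \<chi>)) (\<Union>orbs) = (\<Sum>\<Omega>\<in>orbs. ?v \<Omega>)"
      by (subst sum.Union_disjoint) simp_all
    then show "w = (\<Sum>\<Omega>\<in>orbs. ?v \<Omega>)" using expansion[OF w] unfolding orbits_Union by simp
  qed
  show "v \<Omega> = 0" if v: "\<And>\<Omega>. \<Omega> \<in> orbs \<Longrightarrow> v \<Omega> \<in> V \<Omega>" and z: "(\<Sum>\<Omega>\<in>orbs. v \<Omega>) = 0" and \<Omega>: "\<Omega> \<in> orbs"
    for v \<Omega>
  proof -
    have "ip (v \<Omega>) (X \<chi>) = 0" if \<chi>: "\<chi> \<in> lie_characters L" for \<chi>
    proof (cases "\<chi> \<in> \<Omega>")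
      case True
      have "ip (v \<Omega>') (X \<chi>) = (if \<Omega>' = \<Omega> then ip (v \<Omega>) (X \<chi>) else 0)" if "\<Omega>' \<in> orbs" for \<Omega>'
        using orbits_disjoint[OF that \<Omega>] True ip_V_outside[OF that v[OF that] \<chi>] by auto
      then have "ip (\<Sum>\<Omega>\<in>orbs. v \<Omega>) (X \<chi>) = (\<Sum>\<Omega>'\<in>orbs. if \<Omega>' = \<Omega> then ip (v \<Omega>) (X \<chi>) else 0)"
        unfolding ip_sum by (intro sum.cong) auto
      then show ?thesis using z \<Omega> finite_orbits ip_zero by simp
    qed (use ip_V_outside[OF \<Omega> v[OF \<Omega>] \<chi>] in blast)
    then show ?thesis using expansion[of "v \<Omega>"] v[OF \<Omega>] V_sub_W by auto
  qed
qed (use finite_orbits group_algebra_subspace V_subspace V_sub_W in auto)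

text \<open>
  Since \<open>g\<inverse>xg\<inverse> = x - 2g\<close> in \<open>L(B)\<close>, averaging \<open>u \<mapsto> g u g\<close> against \<open>\<chi>(2g)\<close> projects onto the line
  of \<open>X \<chi>\<close>.
\<close>

lemma project_X:
  assumes \<chi>: "\<chi> \<in> lie_characters L"
  shows "(\<Sum>g\<in>carrier G. cscale (\<chi> g * \<chi> g) (left_regular G g (right_regular G (inv g) u)))
    = cscale (of_nat (order G) * ip u (X \<chi>)) (X \<chi>)"
proof
  fix x
  let ?lhs = "\<Sum>g\<in>carrier G. cscale (\<chi> g * \<chi> g) (left_regular G g (right_regular G (inv g) u))"
  show "?lhs x = cscale (of_nat (order G) * ip u (X \<chi>)) (X \<chi>) x"
  proof (cases "x \<in> carrier G")
    case x: True
    let ?F = "\<lambda>y. \<chi> x * cnj (\<chi> y) * u y"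
    have "\<chi> g * \<chi> g * u (inv g \<otimes> x \<otimes> inv g) = ?F (ladd (inv (g \<otimes> g)) x)" if g: "g \<in> carrier G" for g
    proof -
      let ?y = "ladd (inv (g \<otimes> g)) x"
      have y: "?y = inv g \<otimes> x \<otimes> inv g" using g by (simp add: ladd_def sqroot_inv square_sqroot del: inv_mult_group)
      \<comment> \<open>Doubling in the Lie ring is squaring in the group.\<close>
      have gg: "ladd g g = g \<otimes> g"
      proof -
        have "ladd g g = sqroot g \<otimes> (sqroot g \<otimes> sqroot g) \<otimes> sqroot g" using g by (simp add: ladd_def sqroot_square)
        also have "\<dots> = (sqroot g \<otimes> sqroot g) \<otimes> (sqroot g \<otimes> sqroot g)" using g by (simp add: m_assoc)
        finally show ?thesis using g by (simp add: sqroot_square)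
      qed
      have "ladd (g \<otimes> g) ?y = x" using g x y by (simp add: ladd_def square_sqroot m_assoc inv_cancel_left)
      then have "\<chi> x = \<chi> (g \<otimes> g) * \<chi> ?y"
        using char_ladd[OF \<chi>, of "g \<otimes> g" ?y] g x by simp
      moreover have "\<chi> (g \<otimes> g) = \<chi> g * \<chi> g" using char_ladd[OF \<chi> g g] gg by simp
      ultimately have "\<chi> x * cnj (\<chi> ?y) = \<chi> g * \<chi> g * (\<chi> ?y * cnj (\<chi> ?y))" by simp
      also have "\<chi> ?y * cnj (\<chi> ?y) = 1" using char_cnj[OF \<chi>, of ?y] g x by simp
      finally show ?thesis unfolding y by simp
    qed
    then have "?lhs x = (\<Sum>g\<in>carrier G. ?F (ladd (inv (g \<otimes> g)) x))"
      using x by (auto simp: sum_fun_apply cscale_apply left_regular_apply right_regular_apply intro!: sum.cong)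
    \<comment> \<open>Squaring permutes the group, with inverse \<open>sqroot\<close>; the remaining
      substitutions are inversion and translation in the additive group.\<close>
    also have "\<dots> = (\<Sum>g\<in>carrier G. ?F (ladd (inv g) x))"
      by (rule sum.reindex_bij_betw[where h = "\<lambda>g. g \<otimes> g" and g = "\<lambda>g. ?F (ladd (inv g) x)"])
        (rule bij_betwI[where g = sqroot], auto simp: sqroot_square square_sqroot)
    also have "\<dots> = (\<Sum>g\<in>carrier G. ?F (ladd g x))" by (rule sum_inverse)
    also have "\<dots> = (\<Sum>g\<in>carrier G. ?F g)"
    proof -
      have "group A" using comm_group_A by (simp add: comm_group_def)
      from group.sum_translate(2)[OF this, of x ?F] show ?thesis using x by (simp add: mult_A)
    qed
    also have "\<dots> = cscale (of_nat (order G) * ip u (X \<chi>)) (X \<chi>) x"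
      using x order_pos by (simp add: cscale_apply X_apply galg_inner_def sum_distrib_left mult_ac)
    finally show ?thesis .
  qed (simp add: sum_fun_apply cscale_apply left_regular_apply X_apply)
qed

text \<open>A nonzero \<open>u\<close> in \<open>U\<close> has a nonzero coefficient at some
  \<open>X \<chi>\<close>. The averaging of \<open>project_X\<close> uses only translations, so it
  extracts a nonzero multiple of \<open>X \<chi>\<close> inside \<open>U\<close>.\<close>

lemma V_minimal:
  assumes \<Omega>: "\<Omega> \<in> orbs" and U: "cfun.subspace U" "U \<subseteq> V \<Omega>" "U \<noteq> {0}"
    and left: "\<And>g u. g \<in> carrier G \<Longrightarrow> u \<in> U \<Longrightarrow> left_regular G g u \<in> U"
    and right: "\<And>g u. g \<in> carrier G \<Longrightarrow> u \<in> U \<Longrightarrow> right_regular G g u \<in> U"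
  shows "U = V \<Omega>"
proof -
  obtain u where u: "u \<in> U" "u \<noteq> 0" using U(3) cfun.subspace_0[OF U(1)] by blast
  have uV: "u \<in> V \<Omega>" and uW: "u \<in> W" using u(1) U(2) V_sub_W by auto
  obtain \<chi> where \<chi>: "\<chi> \<in> lie_characters L" "ip u (X \<chi>) \<noteq> 0"
  proof (rule ccontr)
    assume "\<not> thesis"
    then have "ip u (X \<chi>) = 0" if "\<chi> \<in> lie_characters L" for \<chi> using that \<open>\<And>\<chi>. \<chi> \<in> lie_characters L \<Longrightarrow> ip u (X \<chi>) \<noteq> 0 \<Longrightarrow> thesis\<close> by blast
    then show False using expansion[OF uW] u(2) by simp
  qed
  have \<chi>\<Omega>: "\<chi> \<in> \<Omega>" using ip_V_outside[OF \<Omega> uV \<chi>(1)] \<chi>(2) by blast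
  define c where "c = of_nat (order G) * ip u (X \<chi>)"
  have "c \<noteq> 0" using \<chi>(2) order_pos by (simp add: c_def)
  have "cscale c (X \<chi>) \<in> U"
    unfolding c_def project_X[OF \<chi>(1), symmetric]
    using left right u(1) by (intro cfun.subspace_sum cfun.subspace_scale U(1)) auto
  then have "cscale (inverse c) (cscale c (X \<chi>)) \<in> U" by (rule cfun.subspace_scale[OF U(1)])
  then have XU: "X \<chi> \<in> U" using \<open>c \<noteq> 0\<close> by simp
  have "X ` \<Omega> \<subseteq> U"
  proof
    fix y assume "y \<in> X ` \<Omega>"
    then obtain b where b: "b \<in> carrier G" "y = X (coAd G b \<chi>)"
      using orbit_transitive[OF \<Omega> \<chi>\<Omega>] by (auto simp: orbit_def)
    \<comment> \<open>Left and right translation by the same \<open>b\<close> combine to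
      conjugation, which is the coadjoint action on characters.\<close>
    have "y = left_regular G b (right_regular G b (X \<chi>))"
      using b by (auto simp: fun_eq_iff X_apply coAd_apply left_regular_apply right_regular_apply)
    then show "y \<in> U" using left right XU b(1) by simp
  qed
  then have "V \<Omega> \<subseteq> U" unfolding V_orbit_def using U(1) by (rule cfun.span_minimal)
  then show ?thesis using U(2) by blast
qed

theorem V_isotypic_components:
  "\<Omega> \<in> orbs \<Longrightarrow> isotypic G (left_regular G) (V \<Omega>)"
  "\<Omega> \<in> orbs \<Longrightarrow> isotypic G (right_regular G) (V \<Omega>)"
  "isotypic_decomposition G (left_regular G) W orbs V"
  "isotypic_decomposition G (right_regular G) W orbs V"
proof -
  \<comment> \<open>The components of the unit supply the projection coefficients: multiplication by
    \<open>e \<Omega>\<close> lands in the ideal \<open>V \<Omega>\<close>, and these products sum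
    to the identity.\<close>
  obtain e where e: "\<And>\<Omega>. \<Omega> \<in> orbs \<Longrightarrow> e \<Omega> \<in> V \<Omega>" "galg_basis \<one> = (\<Sum>\<Omega>\<in>orbs. e \<Omega>)"
    using direct_sum_decompose[OF V_direct_sum galg_basis_one_closed] by blast
  have eL: "(\<Sum>g\<in>carrier G. cscale (e \<Omega> g) (left_regular G g w)) = galg_mult G (e \<Omega>) w" for \<Omega> w
    by (simp add: galg_mult_left)
  have eR: "(\<Sum>g\<in>carrier G. cscale (e \<Omega> (inv g)) (right_regular G g w)) = galg_mult G w (e \<Omega>)" for \<Omega> w
    by (simp add: galg_mult_right)
  interpret l: commuting_reps G "left_regular G" "right_regular G" W orbs V e "galg_basis ` carrier G"
  proof
    fix \<Omega> w assume \<Omega>: "\<Omega> \<in> orbs" and w: "w \<in> W"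
    show "(\<Sum>g\<in>carrier G. cscale (e \<Omega> g) (left_regular G g w)) \<in> V \<Omega>"
      unfolding eL using ideal.I_r_closed[OF V_ideal[OF \<Omega>] e(1)[OF \<Omega>] w] by simp
  next
    fix w assume w: "w \<in> W"
    show "(\<Sum>\<Omega>\<in>orbs. \<Sum>g\<in>carrier G. cscale (e \<Omega> g) (left_regular G g w)) = w"
      unfolding eL galg_mult_sum_left[symmetric] e(2)[symmetric] using w by (rule galg_mult_one_left)
  qed (use finite_carrier left_regular_rep right_regular_rep left_right_commute V_direct_sum V_nonzero
      V_left_stable V_right_stable V_minimal group_algebra_span_basis[OF finite_carrier] in auto)
  \<comment> \<open>The roles of the two actions are exchanged; the coefficients are taken at
    \<open>inv g\<close> so that the combination of right translations is right multiplication by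
    \<open>e \<Omega>\<close>.\<close>
  interpret r: commuting_reps G "right_regular G" "left_regular G" W orbs V "\<lambda>\<Omega> g. e \<Omega> (inv g)"
    "galg_basis ` carrier G"
  proof
    fix \<Omega> w assume \<Omega>: "\<Omega> \<in> orbs" and w: "w \<in> W"
    show "(\<Sum>g\<in>carrier G. cscale (e \<Omega> (inv g)) (right_regular G g w)) \<in> V \<Omega>"
      unfolding eR using ideal.I_l_closed[OF V_ideal[OF \<Omega>] e(1)[OF \<Omega>] w] by simp
  next
    fix w assume w: "w \<in> W"
    show "(\<Sum>\<Omega>\<in>orbs. \<Sum>g\<in>carrier G. cscale (e \<Omega> (inv g)) (right_regular G g w)) = w"
      unfolding eR galg_mult_sum_right[symmetric] e(2)[symmetric] using w by (rule galg_mult_one_right)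
  qed (use finite_carrier left_regular_rep right_regular_rep left_right_commute[symmetric] V_direct_sum V_nonzero
      V_left_stable V_right_stable V_minimal group_algebra_span_basis[OF finite_carrier] in auto)
  show "\<Omega> \<in> orbs \<Longrightarrow> isotypic G (left_regular G) (V \<Omega>)" by (rule l.V_isotypic)
  show "\<Omega> \<in> orbs \<Longrightarrow> isotypic G (right_regular G) (V \<Omega>)" by (rule r.V_isotypic)
  show "isotypic_decomposition G (left_regular G) W orbs V" by (rule l.V_isotypic_decomposition)
  show "isotypic_decomposition G (right_regular G) W orbs V" by (rule r.V_isotypic_decomposition)
qed

end

theorem theorem5p3:
  fixes B :: "('a, 'm) monoid_scheme" and s :: "'a set \<Rightarrow> 'a" and L :: "'a lie_ring"
  assumes "nilpotent_class_2 B" and "finite (carrier B)" and "odd (order B)"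
    and "central_section B s"
  defines "L \<equiv> lie_ring_of B s"
  shows "orthonormal_basis (galg_inner B) (carrier (group_algebra B)) (lie_characters L) (X_char L)
    \<and> (\<forall>\<Omega> \<in> coadjoint_orbits B L.
         ideal (V_orbit L \<Omega>) (group_algebra B) \<and>
         isotypic B (left_regular B) (V_orbit L \<Omega>) \<and>
         isotypic B (right_regular B) (V_orbit L \<Omega>))
    \<and> isotypic_decomposition B (left_regular B) (carrier (group_algebra B))
         (coadjoint_orbits B L) (V_orbit L)
    \<and> isotypic_decomposition B (right_regular B) (carrier (group_algebra B))
         (coadjoint_orbits B L) (V_orbit L)"
proof -
  interpret group B using assms(1) by (simp add: nilpotent_class_2_def)
  interpret finite_group B by unfold_locales (rule assms(2))
  have "odd_class_2 B"
    using assms(1,3) finite_group_axioms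
    by (simp add: odd_class_2_def odd_class_2_axioms_def nilpotent_class_2_def)
  then interpret lie_ring_setup B s "lie_ring_of B s"
    using assms(4) by (simp_all add: lie_ring_setup_def lie_ring_setup_axioms_def)
  show ?thesis
    unfolding assms(5) using orthonormal_X V_ideal V_isotypic_components by blast
qed

end
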